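(* Let $K_2\subset\mathbb{R}^3$ be the Koch $2$-surface, $s_2=\log 6/\log 2$, and let $a_n$ be the sequence defined below for $K_2$. Then for every $n\in\mathbb N$, $$a_n\ \ge\ \mathcal H^{s_2}(K_2)\ \ge\ a_n\exp\!\left(-\frac{s_2(\sqrt2+\sqrt6)}{2^{\,n-6}}\right).$$
   Context: $K_2$ is the unique nonempty compact set with $K_2=\bigcup_{j=1}^6F_j(K_2)$, where $F_1(x,y,z)=\big(\tfrac{x+\sqrt3/3}{2},\tfrac y2,\tfrac z2\big)$, $F_2(x,y,z)=\big(\tfrac{x+\frac{\sqrt3}{3}\cos\frac{2\pi}3}{2},\tfrac{y+\frac{\sqrt3}{3}\sin\frac{2\pi}3}{2},\tfrac z2\big)$, $F_3(x,y,z)=\big(\tfrac{x+\frac{\sqrt3}{3}\cos\frac{4\pi}3}{2},\tfrac{y+\frac{\sqrt3}{3}\sin\frac{4\pi}3}{2},\tfrac z2\big)$, $F_4(x,y,z)=\big(-\tfrac x6+\tfrac{\sqrt2}3z+\tfrac{\sqrt3}{18},\,-\tfrac y2,\,\tfrac{\sqrt2}3x+\tfrac z6+\tfrac{\sqrt6}{18}\big)$, $F_5(x,y,z)=\big(\tfrac x{12}+\tfrac{\sqrt3}4y-\tfrac{\sqrt2}6z-\tfrac{\sqrt3}{36},\,-\tfrac{\sqrt3}{12}x+\tfrac y4+\tfrac{\sqrt6}6z+\tfrac1{12},\,\tfrac{\sqrt2}3x+\tfrac z6+\tfrac{\sqrt6}{18}\big)$, $F_6(x,y,z)=\big(\tfrac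 x{12}-\tfrac{\sqrt3}4y-\tfrac{\sqrt2}6z-\tfrac{\sqrt3}{36},\,\tfrac{\sqrt3}{12}x+\tfrac y4-\tfrac{\sqrt6}6z-\tfrac1{12},\,\tfrac{\sqrt2}3x+\tfrac z6+\tfrac{\sqrt6}{18}\big)$ (all similitudes of ratio $1/2$). For a word $\omega\in\{1,\dots,6\}^n$ let $F_\omega:=F_{\omega_n}\circ\cdots\circ F_{\omega_1}$; the $n$-cells are the sets $F_\omega(K_2)$ and $K_2^n$ is the set of $n$-cells. $\mu$ is the natural self-similar probability measure on $K_2$ (each $n$-cell has measure $6^{-n}$). $|\cdot|$ is the diameter. Define $$a_n:=\min_{1\le k\le 6^n}\ \min_{\{\Delta_i^{(n)}\}_{i=1}^k\subseteq K_2^n}\frac{|\bigcup_{i=1}^k\Delta_i^{(n)}|^{s_2}}{\mu(\bigcup_{i=1}^k\Delta_i^{(n)})},$$ the inner minimum over all sets of $k$ distinct $n$-cells. *)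

theory Defs
  imports "HOL-Probability.Probability"
begin

type_synonym pt = "real^3"

definition KF1 :: "pt \<Rightarrow> pt" where
  "KF1 p = vector [(p$1 + sqrt 3 / 3) / 2, p$2 / 2, p$3 / 2]"

definition KF2 :: "pt \<Rightarrow> pt" where
  "KF2 p = vector [(p$1 + sqrt 3 / 3 * cos (2*pi/3)) / 2,
                   (p$2 + sqrt 3 / 3 * sin (2*pi/3)) / 2, p$3 / 2]"

definition KF3 :: "pt \<Rightarrow> pt" where
  "KF3 p = vector [(p$1 + sqrt 3 / 3 * cos (4*pi/3)) / 2,
                   (p$2 + sqrt 3 / 3 * sin (4*pi/3)) / 2, p$3 / 2]"

definition KF4 :: "pt \<Rightarrow> pt" where
  "KF4 p = vector [- p$1 / 6 + sqrt 2 / 3 * p$3 + sqrt 3 / 18,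
                   - p$2 / 2,
                   sqrt 2 / 3 * p$1 + p$3 / 6 + sqrt 6 / 18]"

definition KF5 :: "pt \<Rightarrow> pt" where
  "KF5 p = vector [p$1 / 12 + sqrt 3 / 4 * p$2 - sqrt 2 / 6 * p$3 - sqrt 3 / 36,
                   - sqrt 3 / 12 * p$1 + p$2 / 4 + sqrt 6 / 6 * p$3 + 1 / 12,
                   sqrt 2 / 3 * p$1 + p$3 / 6 + sqrt 6 / 18]"

definition KF6 :: "pt \<Rightarrow> pt" where
  "KF6 p = vector [p$1 / 12 - sqrt 3 / 4 * p$2 - sqrt 2 / 6 * p$3 - sqrt 3 / 36,
                   sqrt 3 / 12 * p$1 + p$2 / 4 - sqrt 6 / 6 * p$3 - 1 / 12,
                   sqrt 2 / 3 * p$1 + p$3 / 6 + sqrt 6 / 18]"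

definition KF :: "nat \<Rightarrow> pt \<Rightarrow> pt" where
  "KF j = (if j = 1 then KF1 else if j = 2 then KF2 else if j = 3 then KF3
           else if j = 4 then KF4 else if j = 5 then KF5 else if j = 6 then KF6 else id)"

definition K2 :: "pt set" where
  "K2 = (THE K. compact K \<and> K \<noteq> {} \<and> K = (\<Union>j\<in>{1..6}. KF j ` K))"

fun Fword :: "nat list \<Rightarrow> pt \<Rightarrow> pt" where
  "Fword [] = id"
| "Fword (j # ws) = Fword ws \<circ> KF j"

definition ncells :: "nat \<Rightarrow> pt set set" where
  "ncells n = {Fword w ` K2 | w. length w = n \<and> set w \<subseteq> {1..6}}"

definition mu :: "pt measure" where
  "mu = (THE M. sets M = sets borel \<and> prob_space M \<and>
           (\<forall>A\<in>sets borel. emeasure M A = (\<Sum>j\<in>{1..6}. emeasure M (KF j -` A)) / 6))"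

definition s2 :: real where
  "s2 = ln 6 / ln 2"

definition a_seq :: "nat \<Rightarrow> real" where
  "a_seq n = Min {diameter (\<Union>C) powr s2 / measure mu (\<Union>C) | C. C \<subseteq> ncells n \<and> C \<noteq> {}}"

definition hausdorff_pre :: "real \<Rightarrow> real \<Rightarrow> 'a::metric_space set \<Rightarrow> ennreal" where
  "hausdorff_pre s \<delta> E = (INF U \<in> {U :: nat \<Rightarrow> 'a set. E \<subseteq> (\<Union>i. U i) \<and>
       (\<forall>i. bounded (U i) \<and> diameter (U i) \<le> \<delta>)}. \<Sum>i. ennreal (diameter (U i) powr s))"

definition hausdorff_measure :: "real \<Rightarrow> 'a::metric_space set \<Rightarrow> ennreal" where
  "hausdorff_measure s E = (SUP \<delta> \<in> {0<..}. hausdorff_pre s \<delta> E)"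

end

(* Upper bound: for bounded U, the union of the m-cells meeting U has diameter at most |U| + 2^(1-m);
   covering K2 by this union and by scaled copies of an almost optimal cover of K2 on the remaining
   cells gives, as m grows, H(K2) * mu(U) <= |U|^s. No knowledge of how cells overlap is needed.

   Lower bound: by the mass distribution principle it suffices that |V|^s >= b mu(V) for closed V.
   If |V| is at least a fixed d0, replace V by the union of the n-cells meeting it. If |V| < d0, there
   is a V' with |V'| <= 2 |V| and mu(V') >= 6 mu(V): in coordinates where each pyramid of the surface is
   the corner of a cube, cells are corners at lattice points, all level-5 cells meeting V are adjacent
   to one common lattice point, and near (8, 4, 2) every such configuration reappears at level 4. *)

theory Submission
  imports Defs
begin

section \<open>Iterated function systems of ratio one half\<close>

text \<open>Two obstacles shape the proof. Cells may overlap, so measures are never read off from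
  cells: everything runs through the average over words in \<open>self_similar_iterate\<close>,
  which counts words and takes preimages. And a small set can straddle several cells at every level,
  so it cannot simply be blown up by the inverse of one contraction; it is doubled and moved to a
  place where all cells it meets recur one level higher. Doubling loses nothing because
  \<open>2 powr s2 = 6\<close>.

  The constants come from level 5, where the mesh is \<open>1 / 32\<close>. A common adjacent
  lattice point exists as long as a certain taxicab distance stays below \<open>5 / 3\<close>;
  position inside a cell uses up 1 of this, which leaves \<open>2 / 3\<close> mesh units, that is
  \<open>1 / 48\<close>, for the set itself. The threshold \<open>d0\<close> meets this bound, and
  \<open>2 / d0 = 64 * (sqrt 2 + sqrt 6)\<close> is the constant in the exponent.

  Since \<open>K2\<close> and \<open>mu\<close> are defined by \<open>THE\<close>, existence and
  uniqueness are proved as well, the latter for \<open>mu\<close> among all Borel probability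
  measures.\<close>

locale half_ifs =
  fixes I :: "'i set" and f :: "'i \<Rightarrow> 'a::euclidean_space \<Rightarrow> 'a"
  assumes finite_I: "finite I" and I_nonempty: "I \<noteq> {}"
    and dist_f: "j \<in> I \<Longrightarrow> dist (f j x) (f j y) = dist x y / 2"
begin

text \<open>The head of a word is the innermost map, so putting a letter in front passes to a
  subcell.\<close>

primrec fw :: "'i list \<Rightarrow> 'a \<Rightarrow> 'a" where
  "fw [] = id"
| "fw (j # w) = fw w \<circ> f j"

definition wds :: "nat \<Rightarrow> 'i list set" where
  "wds n = {w. length w = n \<and> set w \<subseteq> I}"

definition self_similar :: "'a measure \<Rightarrow> bool" where
  "self_similar M \<longleftrightarrow> sets M = sets borel \<and> prob_space M \<and>
     (\<forall>A\<in>sets borel. emeasure M A = (\<Sum>j\<in>I. emeasure M (f j -` A)) / of_nat (card I))"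

definition attractor :: "'a set \<Rightarrow> bool" where
  "attractor K \<longleftrightarrow> compact K \<and> K \<noteq> {} \<and> K = (\<Union>j\<in>I. f j ` K)"

lemma card_I: "card I > 0"
  using finite_I I_nonempty by (simp add: card_gt_0_iff)

lemma wds_0 [simp]: "wds 0 = {[]}"
  by (auto simp: wds_def)

lemma wds_Suc: "wds (Suc n) = (\<lambda>(j, w). j # w) ` (I \<times> wds n)"
  by (auto simp: wds_def length_Suc_conv image_iff)

lemma finite_wds [simp]: "finite (wds n)"
  using finite_lists_length_eq[OF finite_I, of n] by (simp add: wds_def conj_commute)

lemma card_wds: "card (wds n) = card I ^ n"
  using card_lists_length_eq[OF finite_I, of n] by (simp add: wds_def conj_commute)

lemma sum_wds_Suc: "(\<Sum>w\<in>wds (Suc n). g w) = (\<Sum>w\<in>wds n. \<Sum>j\<in>I. g (j # w))"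
proof -
  have "(\<Sum>w\<in>wds (Suc n). g w) = (\<Sum>(j, w)\<in>I \<times> wds n. g (j # w))"
    unfolding wds_Suc by (subst sum.reindex) (auto simp: inj_on_def case_prod_unfold)
  also have "\<dots> = (\<Sum>j\<in>I. \<Sum>w\<in>wds n. g (j # w))"
    by (simp add: sum.cartesian_product)
  also have "\<dots> = (\<Sum>w\<in>wds n. \<Sum>j\<in>I. g (j # w))"
    by (rule sum.swap)
  finally show ?thesis .
qed

lemma dist_fw: "w \<in> wds n \<Longrightarrow> dist (fw w x) (fw w y) = dist x y / 2 ^ n"
proof (induction n arbitrary: w x y)
  case (Suc n)
  then show ?case by (auto simp: wds_Suc dist_f)
qed auto

lemma continuous_half:
  assumes "\<And>x y. dist (h x) (h y) = dist x y / c"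
  shows "continuous_on A (h :: 'a \<Rightarrow> 'a)"
proof -
  \<comment> \<open>A basis vector has norm 1, so its image shows
    \<open>1 / c \<ge> 0\<close>.\<close>
  have "c \<ge> 0"
    using assms[of 0 "SOME b. b \<in> Basis"] norm_some_Basis zero_le_dist[of "h 0" "h (SOME b. b \<in> Basis)"]
    by (simp add: zero_le_divide_iff)
  then have "(1 / c)-lipschitz_on A h"
    by (intro lipschitz_onI) (simp_all add: assms)
  then show ?thesis
    by (rule lipschitz_on_continuous_on)
qed

lemma continuous_f: "j \<in> I \<Longrightarrow> continuous_on A (f j)"
  by (rule continuous_half[where c = 2]) (simp add: dist_f)

lemma continuous_fw: "w \<in> wds n \<Longrightarrow> continuous_on A (fw w)"
  by (rule continuous_half[where c = "2 ^ n"]) (simp add: dist_fw)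

lemma vimage_f_borel: "j \<in> I \<Longrightarrow> A \<in> sets borel \<Longrightarrow> f j -` A \<in> sets borel"
  by (rule measurable_sets_borel[OF borel_measurable_continuous_onI]) (simp_all add: continuous_f)

lemma vimage_fw_borel: "w \<in> wds n \<Longrightarrow> A \<in> sets borel \<Longrightarrow> fw w -` A \<in> sets borel"
  by (rule measurable_sets_borel[OF borel_measurable_continuous_onI]) (simp_all add: continuous_fw)

section \<open>The attractor: localisation, uniqueness, existence\<close>

lemma fw_image_subset:
  assumes "\<And>j. j \<in> I \<Longrightarrow> f j ` L \<subseteq> L" "w \<in> wds n"
  shows "fw w ` L \<subseteq> L"
  using assms(2)
proof (induction n arbitrary: w)
  case (Suc n)
  then obtain j v where w: "w = j # v" "j \<in> I" "v \<in> wds n" by (auto simp: wds_Suc)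
  have "fw w ` L = fw v ` (f j ` L)" using w by (simp add: image_comp)
  also have "\<dots> \<subseteq> fw v ` L" using assms(1) w by (intro image_mono)
  also have "\<dots> \<subseteq> L" using Suc w by blast
  finally show ?case .
qed auto

lemma attractor_cells:
  assumes "attractor K"
  shows "K = (\<Union>w\<in>wds n. fw w ` K)"
proof (induction n)
  case (Suc n)
  have "(\<Union>w\<in>wds (Suc n). fw w ` K) = (\<Union>w\<in>wds n. fw w ` (\<Union>j\<in>I. f j ` K))"
    by (auto simp: wds_Suc image_iff Bex_def) blast+
  then show ?case using assms Suc by (simp add: attractor_def)
qed auto

text \<open>A point of \<open>K\<close> is \<open>fw w y\<close> with \<open>w\<close> of any length
  \<open>n\<close>, hence within \<open>D / 2 ^ n\<close> of the point \<open>fw w p\<close> of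
  \<open>L\<close>; closedness does the rest. Besides uniqueness this yields the enclosing simplex
  \<open>tetra\<close>.\<close>

lemma attractor_subset:
  assumes K: "attractor K" and L: "closed L" "L \<noteq> {}" "\<And>j. j \<in> I \<Longrightarrow> f j ` L \<subseteq> L"
  shows "K \<subseteq> L"
proof
  fix x assume x: "x \<in> K"
  obtain p where p: "p \<in> L" using L by blast
  have "bounded K" using K by (simp add: attractor_def compact_imp_bounded)
  then obtain D where D: "\<And>y. y \<in> K \<Longrightarrow> dist p y \<le> D" by (auto simp: bounded_any_center[of _ p])
  have "infdist x L \<le> D / 2 ^ n" for n
  proof -
    obtain w y where wy: "w \<in> wds n" "y \<in> K" "x = fw w y"
      using attractor_cells[OF K, of n] x by blast
    have "fw w p \<in> L" using fw_image_subset[OF L(3) wy(1)] p by blast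
    then have "infdist x L \<le> dist x (fw w p)" by (rule infdist_le)
    also have "\<dots> = dist p y / 2 ^ n" using wy dist_fw by (simp add: dist_commute)
    also have "\<dots> \<le> D / 2 ^ n" using D wy by (intro divide_right_mono) auto
    finally show ?thesis .
  qed
  moreover have "(\<lambda>n. D / 2 ^ n) \<longlonglongrightarrow> 0"
    by (intro LIMSEQ_divide_realpow_zero) auto
  ultimately have "infdist x L \<le> 0"
    by (meson LIMSEQ_le_const)
  then have "infdist x L = 0" using infdist_nonneg[of x L] by linarith
  then show "x \<in> L" using L(1,2) in_closed_iff_infdist_zero by blast
qed

lemma attractor_unique: "attractor K \<Longrightarrow> attractor L \<Longrightarrow> K = L"
  using attractor_subset[of K L] attractor_subset[of L K]
  unfolding attractor_def by (metis UN_upper compact_imp_closed subset_antisym)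

text \<open>The attractor is the closure of the orbit \<open>A\<close> of a fixed point
  \<open>x0\<close> of one of the maps. Starting from a fixed point puts \<open>x0\<close> itself
  into an image of \<open>A\<close>, so \<open>A\<close> is exactly invariant; compactness carries
  this over to the closure.\<close>

lemma attractor_exists: "\<exists>K. attractor K"
proof -
  obtain i where i: "i \<in> I" using I_nonempty by blast
  obtain x0 where x0: "f i x0 = x0"
    using banach_fix_type[of "1 / 2" "f i"] dist_f[OF i] by auto
  \<comment> \<open>\<open>foldr\<close> makes the head the outermost map, opposite to
    \<open>fw\<close>, so that applying a map adds a head letter.\<close>
  define A where "A = {foldr f w x0 | w. set w \<subseteq> I}"
  obtain C where C: "C \<ge> 0" "\<And>j. j \<in> I \<Longrightarrow> dist (f j x0) x0 \<le> C"
  proof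
    show "0 \<le> (\<Sum>j\<in>I. dist (f j x0) x0)" by (simp add: sum_nonneg)
    show "dist (f j x0) x0 \<le> (\<Sum>j\<in>I. dist (f j x0) x0)" if "j \<in> I" for j
      using finite_I that by (intro member_le_sum) auto
  qed
  \<comment> \<open>\<open>2 * C\<close> is the sum of the geometric series
    \<open>C + C / 2 + C / 4 + ...\<close>.\<close>
  have bd: "dist (foldr f w x0) x0 \<le> 2 * C" if "set w \<subseteq> I" for w
    using that
  proof (induction w)
    case (Cons j w)
    have "dist (foldr f (j # w) x0) x0 \<le> dist (f j (foldr f w x0)) (f j x0) + dist (f j x0) x0"
      using dist_triangle by simp
    also have "\<dots> \<le> (2 * C) / 2 + C"
      using Cons C dist_f[of j "foldr f w x0" x0] by (intro add_mono) auto
    finally show ?case by simp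
  qed (use C in auto)
  have "bounded A"
    unfolding A_def bounded_any_center[of _ x0] using bd by (auto simp: dist_commute intro!: exI[of _ "2 * C"])
  then have comp: "compact (closure A)" by (simp add: compact_closure)
  have x0A: "x0 \<in> A" unfolding A_def by (auto intro!: exI[of _ "[]"])
  have TA: "(\<Union>j\<in>I. f j ` A) = A"
  proof (intro equalityI subsetI)
    fix x assume "x \<in> (\<Union>j\<in>I. f j ` A)"
    then obtain j w where "j \<in> I" "set w \<subseteq> I" "x = f j (foldr f w x0)" by (auto simp: A_def)
    then show "x \<in> A" unfolding A_def by (auto intro!: exI[of _ "j # w"])
  next
    fix x assume "x \<in> A"
    then obtain w where w: "set w \<subseteq> I" "x = foldr f w x0" by (auto simp: A_def)
    show "x \<in> (\<Union>j\<in>I. f j ` A)"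
    proof (cases w)
      case Nil
      then show ?thesis using w x0 i x0A by force
    next
      case (Cons j v)
      then show ?thesis using w by (auto simp: A_def)
    qed
  qed
  have cl: "f j ` closure A = closure (f j ` A)" if "j \<in> I" for j
  proof
    show "f j ` closure A \<subseteq> closure (f j ` A)"
      by (rule image_closure_subset[OF continuous_f[OF that]]) (auto intro: closure_subset[THEN subsetD])
    show "closure (f j ` A) \<subseteq> f j ` closure A"
      using comp continuous_f[OF that] closure_subset[of A]
      by (intro closure_minimal image_mono compact_imp_closed compact_continuous_image)
  qed
  have "closure A \<subseteq> (\<Union>j\<in>I. f j ` closure A)"
  proof (rule closure_minimal)
    show "A \<subseteq> (\<Union>j\<in>I. f j ` closure A)"
      using TA closure_subset[of A] by blast
    show "closed (\<Union>j\<in>I. f j ` closure A)"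
      using finite_I comp by (intro compact_imp_closed compact_UN ballI compact_continuous_image continuous_f)
  qed
  moreover have "f j ` closure A \<subseteq> closure A" if "j \<in> I" for j
    unfolding cl[OF that] using TA that by (intro closure_mono) blast
  ultimately have "(\<Union>j\<in>I. f j ` closure A) = closure A" by blast
  then show ?thesis using comp x0A closure_subset[of A] unfolding attractor_def by (metis empty_iff subsetD)
qed

section \<open>Self-similar probability measures: iteration, uniqueness, support, existence\<close>

lemma self_similar_borel: "self_similar M \<Longrightarrow> sets M = sets borel"
  and self_similar_prob: "self_similar M \<Longrightarrow> prob_space M"
  by (auto simp: self_similar_def)

lemma self_similar_measure:
  assumes M: "self_similar M" and A: "A \<in> sets borel"
  shows "measure M A = (\<Sum>j\<in>I. measure M (f j -` A)) / card I"
proof -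
  interpret prob_space M using M by (rule self_similar_prob)
  have "ennreal (measure M A) = (\<Sum>j\<in>I. ennreal (measure M (f j -` A))) / of_nat (card I)"
    using M A by (simp add: self_similar_def flip: emeasure_eq_measure)
  also have "\<dots> = ennreal ((\<Sum>j\<in>I. measure M (f j -` A)) / card I)"
    using card_I by (simp add: sum_ennreal divide_ennreal sum_nonneg flip: ennreal_of_nat_eq_real_of_nat)
      (simp add: ennreal_of_nat_eq_real_of_nat divide_ennreal sum_nonneg)
  finally show ?thesis
    by (simp add: sum_nonneg)
qed

lemma self_similar_iterate:
  assumes M: "self_similar M" and A: "A \<in> sets borel"
  shows "measure M A = (\<Sum>w\<in>wds n. measure M (fw w -` A)) / card I ^ n"
proof (induction n)
  case (Suc n)
  have "(\<Sum>w\<in>wds (Suc n). measure M (fw w -` A)) = (\<Sum>w\<in>wds n. \<Sum>j\<in>I. measure M (f j -` (fw w -` A)))"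
    by (simp add: sum_wds_Suc vimage_comp)
  also have "\<dots> = (\<Sum>w\<in>wds n. card I * measure M (fw w -` A))"
    using card_I by (intro sum.cong refl) (simp add: self_similar_measure[OF M vimage_fw_borel[OF _ A]])
  finally show ?case using Suc card_I by (simp add: sum_distrib_left[symmetric])
qed simp

end

lemma measure_infdist_tendsto:
  fixes A :: "'a::euclidean_space set"
  assumes "finite_measure M" "sets M = sets borel" "closed A" "A \<noteq> {}" "c > 0"
  shows "(\<lambda>n. measure M {x. infdist x A \<le> c / 2 ^ n}) \<longlonglongrightarrow> measure M A"
proof -
  interpret finite_measure M by fact
  have tends: "(\<lambda>n. c / 2 ^ n) \<longlonglongrightarrow> (0::real)"
    by (intro LIMSEQ_divide_realpow_zero) auto
  have eq: "(\<Inter>n. {x. infdist x A \<le> c / 2 ^ n}) = A"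
  proof (intro equalityI subsetI)
    fix x assume "x \<in> (\<Inter>n. {x. infdist x A \<le> c / 2 ^ n})"
    then have "infdist x A \<le> 0"
      using LIMSEQ_le_const[OF tends] by auto
    then have "infdist x A = 0" using infdist_nonneg[of x A] by linarith
    then show "x \<in> A" using assms in_closed_iff_infdist_zero by blast
  qed (use assms in auto)
  have "closed {x. infdist x A \<le> r}" for r
    by (intro closed_Collect_le continuous_intros)
  then have s: "range (\<lambda>n. {x. infdist x A \<le> c / 2 ^ n}) \<subseteq> sets M"
    using assms(2) by auto
  have d: "decseq (\<lambda>n. {x. infdist x A \<le> c / 2 ^ n})"
  proof (intro decseq_SucI subsetI)
    fix n x assume "x \<in> {x. infdist x A \<le> c / 2 ^ Suc n}"
    then have "infdist x A \<le> c / 2 ^ Suc n" by simp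
    also have "\<dots> \<le> c / 2 ^ n" using assms(5) by (simp add: field_simps)
    finally show "x \<in> {x. infdist x A \<le> c / 2 ^ n}" by simp
  qed
  show ?thesis using finite_Lim_measure_decseq[OF s d] unfolding eq .
qed

text \<open>Tightness. The measures competing in the definition of \<open>mu\<close> need not have
  bounded support a priori.\<close>

lemma cball_prob_ge:
  fixes M :: "'a::euclidean_space measure"
  assumes "prob_space M" "sets M = sets borel" "e > 0"
  shows "\<exists>R>0. measure M (cball 0 R) \<ge> 1 - e"
proof -
  interpret prob_space M by fact
  have "(\<lambda>n. measure M (cball 0 (real n))) \<longlonglongrightarrow> measure M (\<Union>n. cball 0 (real n))"
  proof (rule finite_Lim_measure_incseq)
    show "range (\<lambda>n. cball 0 (real n)) \<subseteq> sets M" by (auto simp: assms(2))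
    show "incseq (\<lambda>n. cball (0::'a) (real n))" by (rule incseq_SucI, rule subset_cball) simp
  qed
  moreover have "(\<Union>n. cball (0::'a) (real n)) = UNIV"
    by (auto simp: real_arch_simple)
  moreover have "measure M UNIV = 1"
    using prob_space sets_eq_imp_space_eq[OF assms(2)] by (simp del: prob_space)
  ultimately have "(\<lambda>n. measure M (cball 0 (real n))) \<longlonglongrightarrow> 1" by simp
  then have "\<forall>\<^sub>F n in sequentially. measure M (cball 0 (real n)) > 1 - e"
    by (rule order_tendstoD(1)) (use assms(3) in simp)
  then have "\<forall>\<^sub>F n in sequentially. measure M (cball 0 (real n)) > 1 - e \<and> n > 0"
    using eventually_gt_at_top by (rule eventually_conj)
  then obtain n where "measure M (cball 0 (real n)) > 1 - e" "n > 0"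
    using eventually_happens'[OF sequentially_bot] by blast
  then show ?thesis by (intro exI[of _ "real n"]) auto
qed

context half_ifs
begin

text \<open>Let the ball \<open>B\<close> carry all but \<open>e / 2\<close> of both measures. Its
  image under a word of length \<open>n\<close> has diameter at most \<open>c / 2 ^ n\<close>, so it
  either misses \<open>A\<close>, and then the \<open>M\<close>-term is at most
  \<open>e / 2\<close>, or lies in the neighbourhood \<open>Ad n\<close>, and then the
  \<open>N\<close>-term is at least \<open>1 - e / 2\<close>. Averaging over words and letting
  \<open>n\<close> grow gives the claim.\<close>

lemma self_similar_le:
  assumes M: "self_similar M" and N: "self_similar N" and A: "closed A"
  shows "measure M A \<le> measure N A"
proof (cases "A = {}")
  case False
  interpret M: prob_space M using M by (rule self_similar_prob)
  interpret N: prob_space N using N by (rule self_similar_prob)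
  note sets = self_similar_borel[OF M] self_similar_borel[OF N]
  show ?thesis
  proof (rule field_le_epsilon)
    fix e :: real assume e: "e > 0"
    obtain R1 where R1: "R1 > 0" "measure M (cball 0 R1) \<ge> 1 - e / 2"
      using cball_prob_ge[OF M.prob_space_axioms sets(1), of "e / 2"] e by auto
    obtain R2 where R2: "R2 > 0" "measure N (cball 0 R2) \<ge> 1 - e / 2"
      using cball_prob_ge[OF N.prob_space_axioms sets(2), of "e / 2"] e by auto
    define B where "B = cball (0::'a) (max R1 R2)"
    have MB: "measure M B \<ge> 1 - e / 2"
      using R1 M.finite_measure_mono[of "cball 0 R1" B] sets by (force simp: B_def)
    have NB: "measure N B \<ge> 1 - e / 2"
      using R2 N.finite_measure_mono[of "cball 0 R2" B] sets by (force simp: B_def)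
    define c where "c = 2 * max R1 R2"
    have c: "c > 0" using R1 by (simp add: c_def)
    have cB: "dist x y \<le> c" if "x \<in> B" "y \<in> B" for x y
      using that dist_triangle2[of x y 0] by (simp add: c_def B_def dist_commute)
    define Ad where "Ad n = {x. infdist x A \<le> c / 2 ^ n}" for n :: nat
    have Ad: "closed (Ad n)" for n
      unfolding Ad_def by (intro closed_Collect_le continuous_intros)
    have "measure M A - e \<le> measure N (Ad n)" for n
    proof -
      have *: "measure M (fw w -` A) - e \<le> measure N (fw w -` Ad n)" if w: "w \<in> wds n" for w
      proof (cases "fw w -` A \<inter> B = {}")
        case True
        have "measure M (fw w -` A) \<le> measure M (space M - B)"
          using True sets vimage_fw_borel[OF w, of A] A sets_eq_imp_space_eq[OF sets(1)]
          by (intro M.finite_measure_mono) (auto simp: B_def)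
        also have "\<dots> = 1 - measure M B"
          using sets by (intro M.prob_compl) (simp add: B_def)
        finally show ?thesis using MB e measure_nonneg[of N "fw w -` Ad n"] by linarith
      next
        case False
        then obtain y where y: "fw w y \<in> A" "y \<in> B" by auto
        have "B \<subseteq> fw w -` Ad n"
        proof
          fix x assume x: "x \<in> B"
          have "infdist (fw w x) A \<le> dist (fw w x) (fw w y)" using y by (intro infdist_le)
          also have "\<dots> = dist x y / 2 ^ n" using w by (rule dist_fw)
          also have "\<dots> \<le> c / 2 ^ n" using cB x y by (intro divide_right_mono) auto
          finally show "x \<in> fw w -` Ad n" by (simp add: Ad_def)
        qed
        then have "measure N B \<le> measure N (fw w -` Ad n)"
          using vimage_fw_borel[OF w, of "Ad n"] Ad sets by (intro N.finite_measure_mono) auto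
        then show ?thesis using NB e M.prob_le_1[of "fw w -` A"] by linarith
      qed
      have "measure M A - e = (\<Sum>w\<in>wds n. measure M (fw w -` A) - e) / card I ^ n"
        using card_I A
        by (subst self_similar_iterate[OF M, of _ n]) (simp_all add: sum_subtractf card_wds field_simps)
      also have "\<dots> \<le> (\<Sum>w\<in>wds n. measure N (fw w -` Ad n)) / card I ^ n"
        using * by (intro divide_right_mono sum_mono) auto
      also have "\<dots> = measure N (Ad n)"
        using Ad by (simp add: self_similar_iterate[OF N, of _ n])
      finally show ?thesis .
    qed
    moreover have "(\<lambda>n. measure N (Ad n)) \<longlonglongrightarrow> measure N A"
      unfolding Ad_def using A False c sets
      by (intro measure_infdist_tendsto) (auto intro: N.finite_measure_axioms)
    ultimately have "measure M A - e \<le> measure N A"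
      by (meson LIMSEQ_le_const)
    then show "measure M A \<le> measure N A + e" by simp
  qed
qed simp

lemma self_similar_unique:
  assumes M: "self_similar M" and N: "self_similar N"
  shows "M = N"
proof (rule measure_eqI_generator_eq[where E = "Collect closed" and A = "\<lambda>_. UNIV" and \<Omega> = UNIV])
  interpret M: prob_space M using M by (rule self_similar_prob)
  interpret N: prob_space N using N by (rule self_similar_prob)
  show "Int_stable (Collect (closed :: 'a set \<Rightarrow> bool))" by (auto simp: Int_stable_def)
  show "sets M = sigma_sets UNIV (Collect closed)" "sets N = sigma_sets UNIV (Collect closed)"
    using self_similar_borel[OF M] self_similar_borel[OF N] by (simp_all add: borel_eq_closed)
  show "emeasure M X = emeasure N X" if "X \<in> Collect closed" for X
    using self_similar_le[OF M N, of X] self_similar_le[OF N M, of X] that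
    by (simp add: M.emeasure_eq_measure N.emeasure_eq_measure)
  show "emeasure M UNIV \<noteq> \<infinity>" for i :: nat by (simp add: M.emeasure_eq_measure)
qed auto

text \<open>Every word of length \<open>n\<close> maps a ball of almost full mass into the
  \<open>c / 2 ^ n\<close>-neighbourhood of \<open>K\<close>, because it maps \<open>p\<close> into
  \<open>K\<close>; the average over words inherits the bound.\<close>

lemma self_similar_attractor:
  assumes M: "self_similar M" and K: "attractor K"
  shows "measure M K = 1"
proof -
  interpret M: prob_space M using M by (rule self_similar_prob)
  note sets = self_similar_borel[OF M]
  have cK: "closed K" "K \<noteq> {}" using K by (auto simp: attractor_def compact_imp_closed)
  obtain p where p: "p \<in> K" using cK by blast
  have "1 - e \<le> measure M K" if e: "e > 0" for e
  proof -
    obtain R where R: "R > 0" "measure M (cball 0 R) \<ge> 1 - e"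
      using cball_prob_ge[OF M.prob_space_axioms sets e] by auto
    define c where "c = R + norm p"
    define Kd where "Kd n = {x. infdist x K \<le> c / 2 ^ n}" for n :: nat
    have cl: "closed (Kd n)" for n
      unfolding Kd_def by (intro closed_Collect_le continuous_intros)
    have c: "c > 0" "dist x p \<le> c" if "x \<in> cball 0 R" for x
      using R that dist_triangle2[of x p 0] by (auto simp: c_def add_pos_nonneg)
    have "1 - e \<le> measure M (Kd n)" for n
    proof -
      have "1 - e \<le> measure M (fw w -` Kd n)" if w: "w \<in> wds n" for w
      proof -
        have "cball 0 R \<subseteq> fw w -` Kd n"
        proof
          fix x :: 'a assume x: "x \<in> cball 0 R"
          have "fw w p \<in> K" using attractor_cells[OF K, of n] w p by blast
          then have "infdist (fw w x) K \<le> dist (fw w x) (fw w p)" by (rule infdist_le)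
          also have "\<dots> = dist x p / 2 ^ n" using w by (rule dist_fw)
          also have "\<dots> \<le> c / 2 ^ n" using c x by (intro divide_right_mono) auto
          finally show "x \<in> fw w -` Kd n" by (simp add: Kd_def)
        qed
        then have "measure M (cball 0 R) \<le> measure M (fw w -` Kd n)"
          using vimage_fw_borel[OF w, of "Kd n"] cl sets by (intro M.finite_measure_mono) auto
        then show ?thesis using R by linarith
      qed
      then have "(\<Sum>w\<in>wds n. 1 - e) / card I ^ n \<le> (\<Sum>w\<in>wds n. measure M (fw w -` Kd n)) / card I ^ n"
        by (intro divide_right_mono sum_mono) auto
      also have "\<dots> = measure M (Kd n)"
        using cl by (simp add: self_similar_iterate[OF M, of _ n])
      finally show ?thesis using card_I by (simp add: card_wds)
    qed
    moreover have "(\<lambda>n. measure M (Kd n)) \<longlonglongrightarrow> measure M K"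
      unfolding Kd_def using cK R sets
      by (intro measure_infdist_tendsto) (auto intro: M.finite_measure_axioms simp: c_def add_pos_nonneg)
    ultimately show ?thesis by (meson LIMSEQ_le_const)
  qed
  then have "1 \<le> measure M K + e" if "e > 0" for e using that by force
  then have "1 \<le> measure M K" by (rule field_le_epsilon)
  then show ?thesis using M.prob_le_1[of K] by linarith
qed

end

text \<open>The measure is the law of \<open>code s\<close> for a stream \<open>s\<close> of
  independent uniform letters; splitting off the first letter is the self-similarity equation. The
  alphabet is a finite type, as in the cube model; the Koch maps, indexed by numbers, receive their
  measure from there.\<close>

lemma self_similar_exists:
  fixes f :: "'i::finite \<Rightarrow> 'a::euclidean_space \<Rightarrow> 'a"
  assumes "half_ifs UNIV f"
  shows "\<exists>M. half_ifs.self_similar UNIV f M"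
proof -
  interpret half_ifs UNIV f by fact
  define p where "p = rec_nat (\<lambda>s :: 'i stream. 0 :: 'a) (\<lambda>n q s. f (shd s) (q (stl s)))"
  have p0: "p 0 s = 0" and pS: "p (Suc n) s = f (shd s) (p n (stl s))" for n s
    by (simp_all add: p_def)
  define C where "C = (\<Sum>j\<in>UNIV. norm (f j 0))"
  have step: "dist (p n s) (p (Suc n) s) \<le> C / 2 ^ n" for n s
  proof (induction n arbitrary: s)
    case 0
    have "norm (f (shd s) 0) \<le> C"
      unfolding C_def by (rule member_le_sum) auto
    then show ?case by (simp add: p0 pS)
  next
    case (Suc n)
    have "dist (p (Suc n) s) (p (Suc (Suc n)) s) = dist (p n (stl s)) (p (Suc n) (stl s)) / 2"
      unfolding pS by (rule dist_f) simp
    also have "\<dots> \<le> (C / 2 ^ n) / 2" by (intro divide_right_mono Suc) simp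
    finally show ?case by (simp add: mult.commute)
  qed
  have conv: "convergent (\<lambda>n. p n s)" for s
  proof -
    have "summable (\<lambda>n. C * (1 / 2) ^ n)" by (intro summable_mult summable_geometric) simp
    then have "summable (\<lambda>n. p (Suc n) s - p n s)"
      by (rule summable_comparison_test'[where N = 0])
        (use step[of _ s] in \<open>simp add: dist_norm norm_minus_commute power_divide\<close>)
    then have "convergent (\<lambda>n. \<Sum>k<n. p (Suc k) s - p k s)"
      by (simp add: summable_iff_convergent)
    then show ?thesis by (simp add: sum_lessThan_telescope[of "\<lambda>k. p k s"] p0)
  qed
  define code where "code s = lim (\<lambda>n. p n s)" for s
  have lim: "(\<lambda>n. p n s) \<longlonglongrightarrow> code s" for s
    using conv unfolding code_def by (simp add: convergent_LIMSEQ_iff)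
  have code_Cons: "code (x ## s) = f x (code s)" for x s
  proof -
    have "isCont (f x) (code s)"
      using continuous_f[of x UNIV] by (simp add: continuous_on_eq_continuous_at)
    then have "(\<lambda>n. f x (p n s)) \<longlonglongrightarrow> f x (code s)"
      by (rule isCont_tendsto_compose) (rule lim)
    moreover have "(\<lambda>n. p (Suc n) (x ## s)) \<longlonglongrightarrow> code (x ## s)"
      using lim by (rule LIMSEQ_Suc)
    ultimately show ?thesis by (simp add: pS LIMSEQ_unique)
  qed
  define P where "P = measure_pmf (pmf_of_set (UNIV :: 'i set))"
  interpret P: prob_space P unfolding P_def by unfold_locales
  have setsP: "sets P = sets (count_space UNIV)" by (simp add: P_def)
  let ?S = "stream_space P"
  interpret S: prob_space ?S by (rule P.prob_space_stream_space)
  have spS: "space ?S = UNIV" by (simp add: space_stream_space P_def)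
  have p_meas: "p n \<in> borel_measurable ?S" for n
  proof (induction n)
    case 0
    have "p 0 = (\<lambda>s. 0)" by (rule ext) (rule p0)
    then show ?case by simp
  next
    case (Suc n)
    have sh: "shd \<in> measurable ?S (count_space UNIV)"
      using measurable_shd[of P] by (simp add: measurable_cong_sets[OF refl setsP])
    have "(\<lambda>s. f i (p n (stl s))) \<in> borel_measurable ?S" for i
      by (rule measurable_compose[OF measurable_compose[OF measurable_stl Suc]])
        (intro borel_measurable_continuous_onI continuous_f, simp)
    then have "(\<lambda>s. f (shd s) (p n (stl s))) \<in> borel_measurable ?S"
      using sh by (rule measurable_compose_countable)
    moreover have "p (Suc n) = (\<lambda>s. f (shd s) (p n (stl s)))" by (rule ext) (rule pS)
    ultimately show ?case by simp
  qed
  have code_meas: "code \<in> borel_measurable ?S"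
    using p_meas lim by (rule borel_measurable_LIMSEQ_metric)
  define M where "M = distr ?S borel code"
  have em: "emeasure M A = emeasure ?S (code -` A)" if "A \<in> sets borel" for A
    unfolding M_def using code_meas that by (simp add: emeasure_distr spS)
  have cm: "code -` A \<in> sets ?S" if "A \<in> sets borel" for A
    using measurable_sets[OF code_meas that] by (simp add: spS)
  have "self_similar M"
    unfolding self_similar_def
  proof (intro conjI ballI)
    show "sets M = sets borel" by (simp add: M_def)
    show "prob_space M" unfolding M_def using code_meas by (rule S.prob_space_distr)
    fix A :: "'a set" assume A: "A \<in> sets borel"
    have "emeasure M A = (\<integral>\<^sup>+ s. indicator (code -` A) s \<partial>?S)"
      by (simp add: em[OF A] cm[OF A])
    also have "\<dots> = (\<integral>\<^sup>+ x. (\<integral>\<^sup>+ s. indicator (code -` A) (x ## s) \<partial>?S) \<partial>P)"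
      using cm[OF A] by (intro P.nn_integral_stream_space) auto
    also have "\<dots> = (\<integral>\<^sup>+ x. emeasure M (f x -` A) \<partial>P)"
    proof (rule nn_integral_cong)
      fix x
      have "(\<lambda>s. indicator (code -` A) (x ## s) :: ennreal) = indicator (code -` (f x -` A))"
        by (auto simp: fun_eq_iff code_Cons indicator_def)
      then show "(\<integral>\<^sup>+ s. indicator (code -` A) (x ## s) \<partial>?S) = emeasure M (f x -` A)"
        using vimage_f_borel[of x A] A by (simp add: em cm)
    qed
    also have "\<dots> = (\<Sum>j\<in>UNIV. emeasure M (f j -` A)) / of_nat (card (UNIV :: 'i set))"
      unfolding P_def by (subst nn_integral_pmf_of_set) (auto simp: ennreal_of_nat_eq_real_of_nat)
    finally show "emeasure M A = (\<Sum>j\<in>UNIV. emeasure M (f j -` A)) / of_nat (card (UNIV :: 'i set))" .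
  qed
  then show ?thesis by blast
qed

section \<open>Hausdorff measure\<close>

definition delta_cover :: "real \<Rightarrow> 'a::metric_space set \<Rightarrow> (nat \<Rightarrow> 'a set) \<Rightarrow> bool" where
  "delta_cover \<delta> E U \<longleftrightarrow> E \<subseteq> (\<Union>i. U i) \<and> (\<forall>i. bounded (U i) \<and> diameter (U i) \<le> \<delta>)"

lemma hausdorff_pre_delta_cover:
  "hausdorff_pre s \<delta> E = (INF U \<in> Collect (delta_cover \<delta> E). \<Sum>i. ennreal (diameter (U i) powr s))"
  unfolding hausdorff_pre_def delta_cover_def ..

lemma hausdorff_pre_antimono: "\<delta> \<le> \<delta>' \<Longrightarrow> hausdorff_pre s \<delta>' E \<le> hausdorff_pre s \<delta> E"
  unfolding hausdorff_pre_delta_cover delta_cover_def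
  by (rule INF_superset_mono) (auto intro: order_trans)

lemma hausdorff_pre_mono: "E \<subseteq> F \<Longrightarrow> hausdorff_pre s \<delta> E \<le> hausdorff_pre s \<delta> F"
  unfolding hausdorff_pre_delta_cover delta_cover_def
  by (rule INF_superset_mono) auto

lemma hausdorff_pre_le_diameter:
  assumes "bounded E" "diameter E \<le> \<delta>" "0 \<le> \<delta>"
  shows "hausdorff_pre s \<delta> E \<le> ennreal (diameter E powr s)"
proof -
  \<comment> \<open>Padding with empty sets is free, as \<open>0 powr s = 0\<close>.\<close>
  define U where "U i = (if i = 0 then E else {})" for i :: nat
  have "delta_cover \<delta> E U" using assms by (auto simp: delta_cover_def U_def)
  then have "hausdorff_pre s \<delta> E \<le> (\<Sum>i. ennreal (diameter (U i) powr s))"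
    unfolding hausdorff_pre_delta_cover by (intro INF_lower) simp
  also have "\<dots> = (\<Sum>i\<in>{0}. ennreal (diameter (U i) powr s))"
    by (rule suminf_finite) (auto simp: U_def)
  finally show ?thesis by (simp add: U_def)
qed

lemma hausdorff_pre_empty [simp]: "0 \<le> \<delta> \<Longrightarrow> hausdorff_pre s \<delta> {} = 0"
  using hausdorff_pre_le_diameter[of "{}" \<delta> s] by simp

lemma hausdorff_pre_Un: "hausdorff_pre s \<delta> (E \<union> F) \<le> hausdorff_pre s \<delta> E + hausdorff_pre s \<delta> F"
proof (rule ennreal_le_epsilon)
  fix e :: real
  assume fin: "hausdorff_pre s \<delta> E + hausdorff_pre s \<delta> F < top" and e: "e > 0"
  let ?S = "\<lambda>U. \<Sum>i. ennreal (diameter (U i) powr s)"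
  have fin': "hausdorff_pre s \<delta> E \<noteq> \<infinity>" "hausdorff_pre s \<delta> F \<noteq> \<infinity>" using fin by auto
  obtain U where U: "delta_cover \<delta> E U" "?S U < hausdorff_pre s \<delta> E + ennreal (e / 2)"
    using INF_approx_ennreal[OF half_gt_zero[OF e] hausdorff_pre_delta_cover fin'(1)] by blast
  obtain V where V: "delta_cover \<delta> F V" "?S V < hausdorff_pre s \<delta> F + ennreal (e / 2)"
    using INF_approx_ennreal[OF half_gt_zero[OF e] hausdorff_pre_delta_cover fin'(2)] by blast
  \<comment> \<open>The two covers become rows 0 and 1 of a double sequence whose other rows are
    empty; \<open>prod_decode\<close> enumerates it.\<close>
  define W where "W = (\<lambda>(m::nat, i::nat). if m = 0 then U i else if m = 1 then V i else {})"
  have W: "delta_cover \<delta> (E \<union> F) (\<lambda>k. W (prod_decode k))"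
    unfolding delta_cover_def
  proof (intro conjI allI)
    have "U i \<subseteq> (\<Union>k. W (prod_decode k))" "V i \<subseteq> (\<Union>k. W (prod_decode k))" for i
      using UN_upper[of "prod_encode (0, i)" UNIV "\<lambda>k. W (prod_decode k)"]
        UN_upper[of "prod_encode (1, i)" UNIV "\<lambda>k. W (prod_decode k)"]
      by (simp_all add: W_def)
    then show "E \<union> F \<subseteq> (\<Union>k. W (prod_decode k))"
      using U(1) V(1) unfolding delta_cover_def by blast
  next
    fix k
    obtain m i where "prod_decode k = (m, i)" by fastforce
    moreover have "0 \<le> \<delta>"
      using U(1) diameter_ge_0[of "U 0"] unfolding delta_cover_def by (meson order_trans)
    ultimately show "bounded (W (prod_decode k))" "diameter (W (prod_decode k)) \<le> \<delta>"
      using U(1) V(1) by (auto simp: W_def delta_cover_def)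
  qed
  then have "hausdorff_pre s \<delta> (E \<union> F) \<le> ?S (\<lambda>k. W (prod_decode k))"
    unfolding hausdorff_pre_delta_cover by (intro INF_lower) simp
  also have "\<dots> = (\<Sum>m. \<Sum>i. ennreal (diameter (W (m, i)) powr s))"
    by (rule suminf_ennreal_2dimen) simp
  also have "\<dots> = (\<Sum>m\<in>{0, 1}. \<Sum>i. ennreal (diameter (W (m, i)) powr s))"
    by (rule suminf_finite) (auto simp: W_def)
  also have "\<dots> = ?S U + ?S V" by (simp add: W_def)
  also have "\<dots> \<le> (hausdorff_pre s \<delta> E + ennreal (e / 2)) + (hausdorff_pre s \<delta> F + ennreal (e / 2))"
    using U V by (intro add_mono) auto
  also have "\<dots> = hausdorff_pre s \<delta> E + hausdorff_pre s \<delta> F + (ennreal (e / 2) + ennreal (e / 2))"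
    by (simp add: ac_simps)
  also have "ennreal (e / 2) + ennreal (e / 2) = ennreal e"
    using e by (simp flip: ennreal_plus)
  finally show "hausdorff_pre s \<delta> (E \<union> F) \<le> hausdorff_pre s \<delta> E + hausdorff_pre s \<delta> F + ennreal e" .
qed

lemma hausdorff_pre_UN:
  assumes "finite J" "0 \<le> \<delta>"
  shows "hausdorff_pre s \<delta> (\<Union>j\<in>J. E j) \<le> (\<Sum>j\<in>J. hausdorff_pre s \<delta> (E j))"
  using assms(1)
proof induction
  case (insert j J)
  have "hausdorff_pre s \<delta> (\<Union>i\<in>insert j J. E i)
      \<le> hausdorff_pre s \<delta> (E j) + hausdorff_pre s \<delta> (\<Union>i\<in>J. E i)"
    using hausdorff_pre_Un by simp
  also have "\<dots> \<le> hausdorff_pre s \<delta> (E j) + (\<Sum>i\<in>J. hausdorff_pre s \<delta> (E i))"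
    by (intro add_left_mono insert.IH)
  finally show ?case using insert.hyps by simp
qed (use assms in simp)

lemma diameter_image_le:
  fixes f :: "'a::metric_space \<Rightarrow> 'b::real_normed_vector"
  assumes "bounded S" "r \<ge> 0" "\<And>x y. x \<in> S \<Longrightarrow> y \<in> S \<Longrightarrow> dist (f x) (f y) \<le> r * dist x y"
  shows "diameter (f ` S) \<le> r * diameter S"
proof (rule diameter_le)
  show "f ` S \<noteq> {} \<or> 0 \<le> r * diameter S"
    using assms diameter_ge_0 by auto
  fix u v assume "u \<in> f ` S" "v \<in> f ` S"
  then obtain x y where xy: "x \<in> S" "y \<in> S" "u = f x" "v = f y" by auto
  have "norm (u - v) \<le> r * dist x y" using assms(3) xy by (simp flip: dist_norm)
  also have "\<dots> \<le> r * diameter S"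
    using assms xy by (intro mult_left_mono diameter_bounded_bound)
  finally show "norm (u - v) \<le> r * diameter S" .
qed

lemma bounded_lipschitz_image:
  assumes "bounded S" "r \<ge> 0" "\<And>x y. dist (f x) (f y) \<le> r * dist x y"
  shows "bounded (f ` S)"
proof (cases "S = {}")
  case False
  then obtain a where a: "a \<in> S" by blast
  obtain b where b: "\<And>y. y \<in> S \<Longrightarrow> dist a y \<le> b"
    using assms(1) by (auto simp: bounded_any_center[of _ a])
  have "dist (f a) (f y) \<le> r * b" if "y \<in> S" for y
    using assms(3)[of a y] mult_left_mono[OF b[OF that] assms(2)] by linarith
  then show ?thesis unfolding bounded_def by blast
qed simp

lemma hausdorff_pre_similar:
  fixes f :: "'a::euclidean_space \<Rightarrow> 'a"
  assumes r: "r > 0" and f: "\<And>x y. dist (f x) (f y) = r * dist x y" and s: "s > 0"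
  shows "hausdorff_pre s (r * \<delta>) (f ` E) \<le> ennreal (r powr s) * hausdorff_pre s \<delta> E"
proof -
  let ?c = "ennreal (r powr s)"
  have c: "?c > 0" "?c < top" using r by simp_all
  \<comment> \<open>With the constant on the left the infimum can be treated cover by cover;
    multiplying back is valid since \<open>?c\<close> is positive and finite.\<close>
  have "hausdorff_pre s (r * \<delta>) (f ` E) / ?c \<le> hausdorff_pre s \<delta> E"
    unfolding hausdorff_pre_delta_cover[of s \<delta> E]
  proof (rule INF_greatest)
    fix U assume "U \<in> Collect (delta_cover \<delta> E)"
    then have U: "E \<subseteq> (\<Union>i. U i)" "\<And>i. bounded (U i)" "\<And>i. diameter (U i) \<le> \<delta>"
      by (auto simp: delta_cover_def)
    have d: "diameter (f ` U i) \<le> r * diameter (U i)" for i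
      using U(2) r f by (intro diameter_image_le) auto
    have "delta_cover (r * \<delta>) (f ` E) (\<lambda>i. f ` U i)"
      unfolding delta_cover_def
    proof (intro conjI allI)
      show "f ` E \<subseteq> (\<Union>i. f ` U i)" using U(1) by blast
      show "bounded (f ` U i)" for i
        using U(2) r f by (intro bounded_lipschitz_image[where r = r]) auto
      show "diameter (f ` U i) \<le> r * \<delta>" for i
        using d[of i] mult_left_mono[OF U(3)[of i], of r] r by linarith
    qed
    then have "hausdorff_pre s (r * \<delta>) (f ` E) \<le> (\<Sum>i. ennreal (diameter (f ` U i) powr s))"
      unfolding hausdorff_pre_delta_cover by (intro INF_lower) simp
    also have "\<dots> \<le> (\<Sum>i. ?c * ennreal (diameter (U i) powr s))"
    proof (intro suminf_le allI summableI)
      fix i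
      have "diameter (f ` U i) powr s \<le> (r * diameter (U i)) powr s"
        using U(2) d[of i] s r f
        by (intro powr_mono2 diameter_ge_0 bounded_lipschitz_image[where r = r]) auto
      then show "ennreal (diameter (f ` U i) powr s) \<le> ?c * ennreal (diameter (U i) powr s)"
        using r U(2) by (simp add: powr_mult diameter_ge_0 flip: ennreal_mult)
    qed
    also have "\<dots> = ?c * (\<Sum>i. ennreal (diameter (U i) powr s))"
      by simp
    finally show "hausdorff_pre s (r * \<delta>) (f ` E) / ?c \<le> (\<Sum>i. ennreal (diameter (U i) powr s))"
      using c by (intro divide_le_posI_ennreal)
  qed
  then have "?c * (hausdorff_pre s (r * \<delta>) (f ` E) / ?c) \<le> ?c * hausdorff_pre s \<delta> E"
    by (rule mult_left_mono) simp
  moreover have "?c * (x / ?c) = x" for x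
    using c by (cases x) (auto simp: divide_ennreal ennreal_top_divide ennreal_mult_top r simp flip: ennreal_mult)
  ultimately show ?thesis by simp
qed

text \<open>The mass distribution principle. Closures of the covering sets are measurable and have
  the same diameter, and since \<open>mass\<close> speaks about sets of all sizes, the single scale
  1 gives the bound.\<close>

lemma hausdorff_measure_ge:
  fixes K :: "'a::euclidean_space set" and M :: "'a measure"
  assumes "sets M = sets borel" "prob_space M" "measure M K = 1" "K \<in> sets borel" "b \<ge> 0"
    and mass: "\<And>U. closed U \<Longrightarrow> bounded U \<Longrightarrow> b * measure M U \<le> diameter U powr s"
  shows "ennreal b \<le> hausdorff_measure s K"
proof -
  interpret prob_space M by fact
  have "ennreal b \<le> hausdorff_pre s 1 K"
    unfolding hausdorff_pre_delta_cover
  proof (rule INF_greatest)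
    fix U assume "U \<in> Collect (delta_cover 1 K)"
    then have U: "K \<subseteq> (\<Union>i. U i)" "\<And>i. bounded (U i)"
      by (auto simp: delta_cover_def)
    have s: "range (\<lambda>i. closure (U i)) \<subseteq> sets M" by (auto simp: assms(1))
    have "ennreal b = ennreal b * emeasure M K" by (simp add: emeasure_eq_measure assms(3))
    also have "\<dots> \<le> ennreal b * emeasure M (\<Union>i. closure (U i))"
    proof (intro mult_left_mono emeasure_mono)
      show "K \<subseteq> (\<Union>i. closure (U i))"
        using U(1) closure_subset by (meson UN_mono order_trans subset_refl)
    qed (use s in auto)
    also have "\<dots> \<le> ennreal b * (\<Sum>i. emeasure M (closure (U i)))"
      using s by (intro mult_left_mono emeasure_subadditive_countably) auto
    also have "\<dots> = (\<Sum>i. ennreal b * emeasure M (closure (U i)))" by simp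
    also have "\<dots> \<le> (\<Sum>i. ennreal (diameter (U i) powr s))"
    proof (intro suminf_le allI summableI)
      fix i
      show "ennreal b * emeasure M (closure (U i)) \<le> ennreal (diameter (U i) powr s)"
        using mass[of "closure (U i)"] U(2)[of i] assms(5)
        by (simp add: emeasure_eq_measure diameter_closure bounded_closure flip: ennreal_mult)
    qed
    finally show "ennreal b \<le> (\<Sum>i. ennreal (diameter (U i) powr s))" .
  qed
  also have "\<dots> \<le> hausdorff_measure s K"
    unfolding hausdorff_measure_def by (rule SUP_upper) simp
  finally show ?thesis .
qed

section \<open>Hausdorff measure of an attractor in its similarity dimension\<close>

context half_ifs
begin

text \<open>Words are collected, not cells: words with the same cell count separately, in accordance
  with the equal weights in \<open>self_similar_iterate\<close>.\<close>

definition touching :: "'a set \<Rightarrow> nat \<Rightarrow> 'a set \<Rightarrow> 'i list set" where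
  "touching K n U = {w \<in> wds n. fw w ` K \<inter> U \<noteq> {}}"

lemma finite_touching: "finite (touching K n U)"
  by (simp add: touching_def)

lemma dist_cell:
  assumes "attractor K" "w \<in> wds n" "x \<in> fw w ` K" "y \<in> fw w ` K"
  shows "dist x y \<le> diameter K / 2 ^ n"
proof -
  obtain a b where ab: "a \<in> K" "b \<in> K" "x = fw w a" "y = fw w b" using assms by auto
  have "dist x y = dist a b / 2 ^ n" using ab assms(2) by (simp add: dist_fw)
  also have "\<dots> \<le> diameter K / 2 ^ n"
    using assms(1) ab by (intro divide_right_mono diameter_bounded_bound)
      (auto simp: attractor_def compact_imp_bounded)
  finally show ?thesis .
qed

lemma diameter_touching:
  assumes K: "attractor K" and U: "bounded U"
  shows "diameter (\<Union>w\<in>touching K n U. fw w ` K) \<le> diameter U + 2 * diameter K / 2 ^ n"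
proof (rule diameter_le)
  have "bounded K" using K by (simp add: attractor_def compact_imp_bounded)
  then show "(\<Union>w\<in>touching K n U. fw w ` K) \<noteq> {} \<or> 0 \<le> diameter U + 2 * diameter K / 2 ^ n"
    using U by (simp add: diameter_ge_0)
  fix x y assume x: "x \<in> (\<Union>w\<in>touching K n U. fw w ` K)" and y: "y \<in> (\<Union>w\<in>touching K n U. fw w ` K)"
  obtain u where u: "u \<in> U" "dist x u \<le> diameter K / 2 ^ n"
    using x dist_cell[OF K] unfolding touching_def by blast
  obtain v where v: "v \<in> U" "dist y v \<le> diameter K / 2 ^ n"
    using y dist_cell[OF K] unfolding touching_def by blast
  have "dist x y \<le> dist x u + (dist u v + dist v y)"
    using dist_triangle[of x y u] dist_triangle[of u y v] by linarith
  moreover have "dist u v \<le> diameter U" using U u v by (intro diameter_bounded_bound)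
  ultimately show "norm (x - y) \<le> diameter U + 2 * diameter K / 2 ^ n"
    using u v by (simp add: dist_commute flip: dist_norm)
qed

lemma compact_touching:
  assumes "attractor K"
  shows "compact (\<Union>w\<in>touching K n U. fw w ` K)"
  using assms finite_touching unfolding attractor_def
  by (intro compact_UN ballI compact_continuous_image) (auto simp: touching_def continuous_fw)

lemma measure_inter_attractor:
  assumes K: "attractor K" and M: "self_similar M" and A: "A \<in> sets borel" and B: "B \<in> sets borel"
    and "A \<inter> K \<subseteq> B"
  shows "measure M A \<le> measure M B"
proof -
  interpret prob_space M using M by (rule self_similar_prob)
  have Kb: "K \<in> sets M"
    using K self_similar_borel[OF M] by (simp add: attractor_def compact_imp_closed)
  have "measure M (space M - K) = 0"
    using prob_compl[OF Kb] self_similar_attractor[OF M K] by simp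
  then have "measure M A = measure M (A - (space M - K))"
    using A Kb self_similar_borel[OF M] by (subst finite_measure_Diff') (auto simp: measure_eq_0_null_sets
      intro!: antisym order_trans[OF finite_measure_mono[of "A \<inter> (space M - K)" "space M - K"]])
  also have "\<dots> \<le> measure M B"
    using assms(5) A B self_similar_borel[OF M] sets.sets_into_space[of A M]
    by (intro finite_measure_mono) auto
  finally show ?thesis .
qed

lemma measure_le_touching:
  assumes K: "attractor K" and M: "self_similar M" and U: "U \<in> sets borel"
  shows "measure M U \<le> measure M (\<Union>w\<in>touching K n U. fw w ` K)"
proof (rule measure_inter_attractor[OF K M U])
  show "(\<Union>w\<in>touching K n U. fw w ` K) \<in> sets borel"
    using compact_touching[OF K] by (simp add: compact_imp_closed)
  show "U \<inter> K \<subseteq> (\<Union>w\<in>touching K n U. fw w ` K)"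
    using attractor_cells[OF K, of n] unfolding touching_def by blast
qed

text \<open>In the average over words, a touching word contributes at most 1; for any other word the
  preimage of \<open>U\<close> misses \<open>K\<close> and is null.\<close>

lemma measure_le_card_touching:
  assumes K: "attractor K" and M: "self_similar M" and U: "U \<in> sets borel"
  shows "measure M U \<le> card (touching K n U) / card I ^ n"
proof -
  interpret prob_space M using M by (rule self_similar_prob)
  have "measure M (fw w -` U) \<le> (if w \<in> touching K n U then 1 else 0)" if w: "w \<in> wds n" for w
  proof (cases "w \<in> touching K n U")
    case False
    then have "measure M (fw w -` U) \<le> measure M {}"
      using w vimage_fw_borel[OF w U] by (intro measure_inter_attractor[OF K M]) (auto simp: touching_def)
    then show ?thesis using False by simp
  qed simp
  then have "(\<Sum>w\<in>wds n. measure M (fw w -` U)) \<le> (\<Sum>w\<in>wds n. if w \<in> touching K n U then 1 else 0)"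
    by (rule sum_mono)
  also have "\<dots> = card (touching K n U)"
  proof -
    have "wds n \<inter> touching K n U = touching K n U" by (auto simp: touching_def)
    then show ?thesis by (simp flip: sum.inter_restrict)
  qed
  finally show ?thesis
    using U card_I by (simp add: self_similar_iterate[OF M, of _ n] divide_right_mono)
qed

context
  fixes K s
  assumes K: "attractor K" and s: "s > 0" "2 powr s = real (card I)"
begin

text \<open>The equation \<open>2 powr s = card I\<close> turns the scaling factor
  \<open>(1 / 2 ^ n) powr s\<close> into the weight of a word of length \<open>n\<close>.\<close>

lemma hausdorff_pre_cell:
  assumes "w \<in> wds n"
  shows "hausdorff_pre s (\<delta> / 2 ^ n) (fw w ` E) \<le> ennreal (1 / card I ^ n) * hausdorff_pre s \<delta> E"
proof -
  have "(1 / 2 ^ n) powr s = 1 / (2 powr s) ^ n"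
    by (simp add: powr_divide powr_powr powr_realpow[symmetric] mult.commute)
  then show ?thesis
    using hausdorff_pre_similar[of "1 / 2 ^ n" "fw w" s \<delta> E] assms s by (simp add: dist_fw)
qed

text \<open>A cover at scale \<open>\<delta>'\<close> copied into all \<open>card I ^ n\<close>
  cells is a cover at scale \<open>\<delta>' / 2 ^ n\<close> of at most the same total cost. Hence
  the Hausdorff measure of \<open>K\<close> equals its content at any scale, and large sets are
  admissible in covers.\<close>

lemma hausdorff_pre_attractor_le:
  assumes "\<delta> > 0" "\<delta>' > 0"
  shows "hausdorff_pre s \<delta> K \<le> hausdorff_pre s \<delta>' K"
proof -
  obtain n where n: "\<delta>' / \<delta> < 2 ^ n" using real_arch_pow[of 2 "\<delta>' / \<delta>"] by auto
  then have le: "\<delta>' / 2 ^ n \<le> \<delta>" using assms by (simp add: field_simps)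
  have "hausdorff_pre s \<delta> K \<le> hausdorff_pre s (\<delta>' / 2 ^ n) K"
    using le by (rule hausdorff_pre_antimono)
  also have "\<dots> \<le> hausdorff_pre s (\<delta>' / 2 ^ n) (\<Union>w\<in>wds n. fw w ` K)"
    using attractor_cells[OF K, of n] by simp
  also have "\<dots> \<le> (\<Sum>w\<in>wds n. hausdorff_pre s (\<delta>' / 2 ^ n) (fw w ` K))"
    using assms by (intro hausdorff_pre_UN) auto
  also have "\<dots> \<le> (\<Sum>w\<in>wds n. ennreal (1 / card I ^ n) * hausdorff_pre s \<delta>' K)"
    by (intro sum_mono hausdorff_pre_cell)
  also have "\<dots> = ennreal (card I ^ n) * ennreal (1 / card I ^ n) * hausdorff_pre s \<delta>' K"
    by (simp add: card_wds ennreal_of_nat_eq_real_of_nat mult.assoc)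
  also have "ennreal (card I ^ n) * ennreal (1 / card I ^ n) = 1"
    using card_I by (simp flip: ennreal_mult)
  finally show ?thesis by simp
qed

lemma hausdorff_measure_attractor:
  assumes "\<delta> > 0"
  shows "hausdorff_measure s K = hausdorff_pre s \<delta> K"
  unfolding hausdorff_measure_def
proof (rule antisym)
  show "(SUP \<epsilon>\<in>{0<..}. hausdorff_pre s \<epsilon> K) \<le> hausdorff_pre s \<delta> K"
    using assms by (intro SUP_least hausdorff_pre_attractor_le) auto
  show "hausdorff_pre s \<delta> K \<le> (SUP \<epsilon>\<in>{0<..}. hausdorff_pre s \<epsilon> K)"
    using assms by (intro SUP_upper) auto
qed

text \<open>Finiteness is what permits the cancellation of \<open>h\<close> in
  \<open>hausdorff_measure_touching\<close>.\<close>

lemma hausdorff_measure_attractor_finite: "hausdorff_measure s K < top"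
proof -
  have bK: "bounded K" using K by (simp add: attractor_def compact_imp_bounded)
  then have "hausdorff_measure s K \<le> ennreal (diameter K powr s)"
    using hausdorff_pre_le_diameter[of K "diameter K + 1" s] diameter_ge_0[OF bK]
    by (simp add: hausdorff_measure_attractor[of "diameter K + 1"])
  then show ?thesis using le_less_trans ennreal_less_top by blast
qed

lemma hausdorff_measure_touching:
  "enn2real (hausdorff_measure s K) * (card (touching K n U) / card I ^ n)
    \<le> diameter (\<Union>w\<in>touching K n U. fw w ` K) powr s"
proof -
  let ?T = "touching K n U" and ?N = "real (card I) ^ n"
  define V where "V = (\<Union>w\<in>?T. fw w ` K)"
  have bV: "bounded V" unfolding V_def by (rule compact_imp_bounded[OF compact_touching[OF K]])
  \<comment> \<open>A scale large enough for \<open>V\<close> itself to serve as one covering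
    set.\<close>
  define D where "D = diameter V + 1"
  have D: "D > 0" using diameter_ge_0[OF bV] by (simp add: D_def)
  define h where "h = enn2real (hausdorff_measure s K)"
  have h: "hausdorff_pre s \<delta> K = ennreal h" if "\<delta> > 0" for \<delta>
    using hausdorff_measure_attractor_finite hausdorff_measure_attractor[OF that]
    by (simp add: h_def)
  have h0: "h \<ge> 0" by (simp add: h_def)
  have N: "?N > 0" using card_I by simp
  have TN: "card ?T \<le> card I ^ n"
    unfolding card_wds[symmetric] by (rule card_mono) (auto simp: touching_def)
  have "(\<Union>w\<in>wds n. fw w ` K) \<subseteq> V \<union> (\<Union>w\<in>wds n - ?T. fw w ` K)"
    unfolding V_def by blast
  then have "K \<subseteq> V \<union> (\<Union>w\<in>wds n - ?T. fw w ` K)"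
    using attractor_cells[OF K, of n] by simp
  then have "ennreal h \<le> hausdorff_pre s D (V \<union> (\<Union>w\<in>wds n - ?T. fw w ` K))"
    using h[OF D] hausdorff_pre_mono by metis
  also have "\<dots> \<le> hausdorff_pre s D V + hausdorff_pre s D (\<Union>w\<in>wds n - ?T. fw w ` K)"
    by (rule hausdorff_pre_Un)
  also have "\<dots> \<le> ennreal (diameter V powr s) + (\<Sum>w\<in>wds n - ?T. ennreal (1 / ?N) * ennreal h)"
  proof (rule add_mono)
    show "hausdorff_pre s D V \<le> ennreal (diameter V powr s)"
      using bV D by (intro hausdorff_pre_le_diameter) (auto simp: D_def)
    have "hausdorff_pre s D (\<Union>w\<in>wds n - ?T. fw w ` K) \<le> (\<Sum>w\<in>wds n - ?T. hausdorff_pre s D (fw w ` K))"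
      using D by (intro hausdorff_pre_UN) auto
    also have "\<dots> \<le> (\<Sum>w\<in>wds n - ?T. ennreal (1 / ?N) * ennreal h)"
    proof (rule sum_mono)
      fix w assume "w \<in> wds n - ?T"
      then have "hausdorff_pre s (D * 2 ^ n / 2 ^ n) (fw w ` K) \<le> ennreal (1 / ?N) * hausdorff_pre s (D * 2 ^ n) K"
        using hausdorff_pre_cell[of w n "D * 2 ^ n" K] by simp
      then show "hausdorff_pre s D (fw w ` K) \<le> ennreal (1 / ?N) * ennreal h"
        using h[of "D * 2 ^ n"] D by simp
    qed
    finally show "hausdorff_pre s D (\<Union>w\<in>wds n - ?T. fw w ` K) \<le> \<dots>" .
  qed
  also have "(\<Sum>w\<in>wds n - ?T. ennreal (1 / ?N) * ennreal h) = ennreal ((?N - card ?T) * (h / ?N))"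
  proof -
    have "card (wds n - ?T) = card I ^ n - card ?T"
      unfolding card_wds[symmetric] by (intro card_Diff_subset finite_touching) (auto simp: touching_def)
    then have "real (card (wds n - ?T)) = ?N - card ?T" using TN by (simp add: of_nat_diff)
    moreover have "ennreal (1 / ?N) * ennreal h = ennreal (h / ?N)"
      using h0 N by (simp flip: ennreal_mult)
    moreover have "(\<Sum>w\<in>wds n - ?T. ennreal (h / ?N)) = ennreal (\<Sum>w\<in>wds n - ?T. h / ?N)"
      using h0 by (intro sum_ennreal) simp
    ultimately show ?thesis by simp
  qed
  also have "ennreal (diameter V powr s) + \<dots> = ennreal (diameter V powr s + (?N - card ?T) * (h / ?N))"
    using h0 N TN by (intro ennreal_plus[symmetric] mult_nonneg_nonneg) (auto simp flip: of_nat_power)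
  finally have "h \<le> diameter V powr s + (?N - card ?T) * (h / ?N)"
    using h0 N TN by (subst (asm) ennreal_le_iff)
      (auto intro!: add_nonneg_nonneg mult_nonneg_nonneg simp flip: of_nat_power)
  also have "(?N - card ?T) * (h / ?N) = h - h * (card ?T / ?N)"
    using N by (simp add: field_simps)
  finally show ?thesis by (simp add: V_def h_def)
qed

lemma hausdorff_measure_le:
  assumes M: "self_similar M" and U: "U \<in> sets borel" "bounded U" and pos: "measure M U > 0"
  shows "hausdorff_measure s K \<le> ennreal (diameter U powr s / measure M U)"
proof -
  define h where "h = enn2real (hausdorff_measure s K)"
  have h: "hausdorff_measure s K = ennreal h" "h \<ge> 0"
    using hausdorff_measure_attractor_finite by (simp_all add: h_def)
  have bK: "bounded K" using K by (simp add: attractor_def compact_imp_bounded)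
  have "h * measure M U \<le> (diameter U + 2 * diameter K / 2 ^ n) powr s" for n
  proof -
    have "h * measure M U \<le> h * (card (touching K n U) / card I ^ n)"
      using measure_le_card_touching[OF K M U(1)] h(2) by (intro mult_left_mono) auto
    also have "\<dots> \<le> diameter (\<Union>w\<in>touching K n U. fw w ` K) powr s"
      unfolding h_def by (rule hausdorff_measure_touching)
    also have "\<dots> \<le> (diameter U + 2 * diameter K / 2 ^ n) powr s"
      using s diameter_touching[OF K U(2)] compact_touching[OF K]
      by (intro powr_mono2 diameter_ge_0) (auto intro: compact_imp_bounded)
    finally show ?thesis .
  qed
  moreover have "(\<lambda>n. (diameter U + 2 * diameter K / 2 ^ n) powr s) \<longlonglongrightarrow> (diameter U + 0) powr s"
    using s U(2) bK by (intro tendsto_powr' tendsto_intros LIMSEQ_divide_realpow_zero)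
      (auto intro!: always_eventually simp: diameter_ge_0)
  ultimately have "h * measure M U \<le> diameter U powr s"
    using LIMSEQ_le_const[of _ "(diameter U + 0) powr s" "h * measure M U"] by auto
  then show ?thesis using pos h by (simp add: field_simps)
qed

end

end

section \<open>The surface in cube coordinates\<close>

text \<open>Both maps of axis \<open>fst a\<close> send the origin to half the unit vector of that
  axis; the flag \<open>False\<close> adds a reflection of the axis. Without the coordinate
  transpositions of the Koch maps, the orientation of a cell is just a triple of signs.\<close>

definition G :: "3 \<times> bool \<Rightarrow> real^3 \<Rightarrow> real^3" where
  "G a x = (\<chi> k. ((if k = fst a then 1 else 0) + (if k = fst a \<and> \<not> snd a then - x$k else x$k)) / 2)"

interpretation cube: half_ifs UNIV G
proof
  fix a and x y :: "real^3"
  have "dist (G a x $ k) (G a y $ k) = dist (x $ k) (y $ k) * (1 / 2)" for k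
    by (auto simp: G_def dist_real_def abs_if field_simps)
  then have "dist (G a x) (G a y) = L2_set (\<lambda>k. dist (x $ k) (y $ k) * (1 / 2)) UNIV"
    by (simp only: dist_vec_def)
  also have "\<dots> = dist x y * (1 / 2)"
    by (subst L2_set_left_distrib[symmetric]) (simp_all add: dist_vec_def)
  finally show "dist (G a x) (G a y) = dist x y / 2" by simp
qed auto

text \<open>The cell of a word of length \<open>n\<close> is a corner of the cube lattice of mesh \<open>2 ^ -n\<close>; it has
  its apex at \<open>apx\<close> (in units of the mesh) and its legs point in the directions \<open>sg\<close>. For
  nonempty words exactly one coordinate of the apex is odd.\<close>

fun sg :: "(3 \<times> bool) list \<Rightarrow> 3 \<Rightarrow> int" where
  "sg [] k = 1"
| "sg (a # w) k = (if k = fst a \<and> \<not> snd a then - sg w k else sg w k)"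

fun apx :: "(3 \<times> bool) list \<Rightarrow> 3 \<Rightarrow> int" where
  "apx [] k = 0"
| "apx (a # w) k = 2 * apx w k + (if k = fst a then sg w k else 0)"

lemma fw_cube: "cube.fw w x $ k = (of_int (apx w k) + of_int (sg w k) * x $ k) / 2 ^ length w"
proof (induction w arbitrary: x)
  case (Cons a w)
  have "cube.fw (a # w) x $ k = (of_int (apx w k) + of_int (sg w k) * G a x $ k) / 2 ^ length w"
    using Cons by simp
  also have "\<dots> = (of_int (apx (a # w) k) + of_int (sg (a # w) k) * x $ k) / 2 ^ length (a # w)"
    by (simp add: G_def field_simps)
  finally show ?case .
qed simp

lemma sg_cases: "sg w k = 1 \<or> sg w k = -1"
  by (induction w) auto

lemma odd_sg: "odd (sg w k)"
  using sg_cases[of w k] by auto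

lemma odd_apx_Cons: "odd (apx (a # w) k) \<longleftrightarrow> k = fst a"
  by (simp add: odd_sg)

lemma odd_apx: "w \<noteq> [] \<Longrightarrow> odd (apx w k) \<longleftrightarrow> k = fst (hd w)"
  using odd_apx_Cons[of "hd w" "tl w" k] by simp

lemma odd_sum_apx:
  assumes "w \<noteq> []"
  shows "odd (\<Sum>k\<in>UNIV. apx w k)"
proof -
  have "even (apx w k) \<longleftrightarrow> k \<noteq> fst (hd w)" for k
    using odd_apx[OF assms, of k] by blast
  then show ?thesis using exhaust_3[of "fst (hd w)"] by (elim disjE) (simp_all add: sum_3)
qed

text \<open>Parity of the apex reveals the axis \<open>i\<close> of the head letter. If the tails
  had different signs at \<open>i\<close>, they would be nonempty, and their apexes would differ by
  1 at \<open>i\<close> and agree elsewhere; this is impossible, because each has exactly one odd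
  coordinate.\<close>

lemma cell_code_inj:
  assumes "length v = length w" "apx v = apx w" "sg v = sg w"
  shows "v = w"
  using assms
proof (induction v w rule: list_induct2)
  case (Cons a v b w)
  define i where "i = fst a"
  have ib: "fst b = i"
    using odd_apx_Cons[of a v i] odd_apx_Cons[of b w i] Cons.prems(1) by (simp add: i_def del: apx.simps)
  have ap: "2 * apx v k + (if k = i then sg v k else 0) = 2 * apx w k + (if k = i then sg w k else 0)" for k
    using fun_cong[OF Cons.prems(1), of k] ib by (simp add: i_def)
  have s: "sg v k = sg w k" if "k \<noteq> i" for k
    using fun_cong[OF Cons.prems(2), of k] ib that by (simp add: i_def)
  have si: "sg v i = sg w i"
  proof (rule ccontr)
    assume ne: "sg v i \<noteq> sg w i"
    then have ne': "v \<noteq> []" "w \<noteq> []" using Cons.hyps by auto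
    have "apx v i - apx w i = 1 \<or> apx v i - apx w i = -1"
      using ap[of i] ne sg_cases[of v i] sg_cases[of w i] by auto
    then have 1: "odd (apx v i) \<longleftrightarrow> even (apx w i)" by presburger
    have 2: "odd (apx v k) \<longleftrightarrow> odd (apx w k)" if "k \<noteq> i" for k
      using ap[of k] that by simp
    show False
      using 1 2 odd_apx[OF ne'(1)] odd_apx[OF ne'(2)] by metis
  qed
  have sv: "sg v = sg w" using s si by (metis ext)
  have "apx v = apx w"
  proof
    fix k show "apx v k = apx w k" using ap[of k] unfolding sv by auto
  qed
  with sv Cons.IH have "v = w" by simp
  moreover have "snd a = snd b"
    using fun_cong[OF Cons.prems(2), of i] ib sv sg_cases[of w i] by (auto simp: i_def split: if_splits)
  ultimately show ?case using ib by (simp add: i_def prod_eq_iff)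
qed simp

text \<open>Every neighbour of the lattice point \<open>(8, 4, 2)\<close> is the apex of a level-4 cell in each
  of the eight orientations.\<close>

lemma cells_around_hub:
  fixes q e :: "3 \<Rightarrow> int" and hub :: "3 \<Rightarrow> int"
  assumes q: "(\<Sum>k\<in>UNIV. \<bar>q k\<bar>) = 1" and e: "\<And>k. e k = 1 \<or> e k = -1"
    and hub: "hub 1 = 8" "hub 2 = 4" "hub 3 = 2"
  shows "\<exists>w. length w = 4 \<and> apx w = (\<lambda>k. hub k + q k) \<and> sg w = e"
proof -
  obtain i where i: "\<And>k. k \<noteq> i \<Longrightarrow> q k = 0" "q i = 1 \<or> q i = -1"
  proof -
    have *: "\<bar>q 1\<bar> + \<bar>q 2\<bar> + \<bar>q 3\<bar> = 1" using q by (simp add: sum_3)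
    then consider "\<bar>q 1\<bar> = 1" | "\<bar>q 2\<bar> = 1" | "\<bar>q 3\<bar> = 1" by linarith
    then show thesis
    proof cases
      case 1 with * have "q 2 = 0" "q 3 = 0" by linarith+
      then show ?thesis using that[of 1] 1 exhaust_3 by (metis abs_eq_iff' abs_minus_cancel zero_le_one)
    next
      case 2 with * have "q 1 = 0" "q 3 = 0" by linarith+
      then show ?thesis using that[of 2] 2 exhaust_3 by (metis abs_eq_iff' abs_minus_cancel zero_le_one)
    next
      case 3 with * have "q 1 = 0" "q 2 = 0" by linarith+
      then show ?thesis using that[of 3] 3 exhaust_3 by (metis abs_eq_iff' abs_minus_cancel zero_le_one)
    qed
  qed
  \<comment> \<open>The three outer letters use each axis once: they reach the apex
    \<open>(4, 2, 1)\<close> with arbitrary signs \<open>e'\<close>. The innermost letter doubles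
    this to the hub, steps by \<open>e' i = q i\<close> along axis \<open>i\<close>, and reflects
    that axis if \<open>e i\<close> differs from \<open>q i\<close>.\<close>
  define e' where "e' = e(i := q i)"
  let ?w = "[(i, e i = q i), (3, e' 3 = 1), (2, e' 2 = 1), (1, e' 1 = 1)]"
  have "apx ?w k = hub k + q k" for k
    using exhaust_3[of k] exhaust_3[of i] i(1)[of 1] i(1)[of 2] i(1)[of 3] i(2) e[of 1] e[of 2] e[of 3] hub
    by (auto simp: e'_def)
  moreover have "sg ?w k = e k" for k
  proof -
    have e': "e' m = 1 \<or> e' m = -1" for m using e i(2) by (auto simp: e'_def)
    let ?v = "[(3, e' 3 = 1), (2, e' 2 = 1), (1, e' 1 = 1)]"
    have v: "sg ?v k = e' k"
      using exhaust_3[of k] e'[of k] by (elim disjE) simp_all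
    have "sg ?w k = (if k = fst (i, e i = q i) \<and> \<not> snd (i, e i = q i) then - sg ?v k else sg ?v k)"
      by (rule sg.simps(2))
    then have "sg ?w k = (if k = i \<and> e i \<noteq> q i then - e' k else e' k)"
      by (simp only: v fst_conv snd_conv)
    then show ?thesis using e[of i] i(2) by (auto simp: e'_def simp del: sg.simps)
  qed
  ultimately show ?thesis
    by (intro exI[of _ ?w]) (simp add: fun_eq_iff del: sg.simps apx.simps)
qed

section \<open>Cells near a small set, and the enlargement of small sets\<close>

definition tetra :: "(real^3) set" where
  "tetra = {x. (\<forall>k. 0 \<le> x $ k) \<and> (\<Sum>k\<in>UNIV. x $ k) \<le> 1}"

lemma closed_tetra: "closed tetra"
proof -
  have eq: "tetra = (\<Inter>k. {x. 0 \<le> x $ k}) \<inter> {x. (\<Sum>k\<in>UNIV. x $ k) \<le> 1}"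
    by (auto simp: tetra_def)
  show ?thesis
    unfolding eq by (intro closed_Int closed_INT ballI closed_Collect_le continuous_intros)
qed

lemma G_tetra: "G a ` tetra \<subseteq> tetra"
proof (rule image_subsetI)
  fix x assume "x \<in> tetra"
  then have "0 \<le> x $ 1" "0 \<le> x $ 2" "0 \<le> x $ 3" "x $ 1 + x $ 2 + x $ 3 \<le> 1"
    by (auto simp: tetra_def sum_3)
  then show "G a x \<in> tetra"
    using exhaust_3[of "fst a"] by (auto simp: tetra_def sum_3 forall_3 G_def field_simps)
qed

text \<open>The simplex \<open>tetra\<close> stands in for the attractor from here on: it also has
  full measure, and its linear inequalities bound positions inside a cell.\<close>

lemma self_similar_tetra:
  assumes M: "cube.self_similar M"
  shows "measure M tetra = 1"
proof -
  interpret prob_space M using M by (rule cube.self_similar_prob)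
  obtain K where K: "cube.attractor K" using cube.attractor_exists by blast
  have "0 \<in> tetra" by (simp add: tetra_def)
  then have "K \<subseteq> tetra" using cube.attractor_subset[OF K closed_tetra] G_tetra by blast
  then have "measure M K \<le> measure M tetra"
    using closed_tetra cube.self_similar_borel[OF M] by (intro finite_measure_mono) auto
  then show ?thesis using cube.self_similar_attractor[OF M K] prob_le_1[of tetra] by linarith
qed

text \<open>The taxicab norm of \<open>a\<close> is even and below \<open>1 + 5 / 3\<close>, hence 0
  or 2. If it is 2 and \<open>a\<close> has no component in the direction \<open>t\<close> of the
  dominant coordinate, then its distance from \<open>d\<close> is at least
  \<open>2 + |d1| - |d2| - |d3|\<close>, which is at least \<open>5 / 3\<close>. The bound is sharp:
  take \<open>d = (1/3, 1/3, 1/3)\<close> and \<open>a = (0, 1, 1)\<close>.\<close>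

lemma neighbour_arith:
  fixes d1 d2 d3 :: real and a1 a2 a3 t :: int
  assumes "\<bar>d1\<bar> + \<bar>d2\<bar> + \<bar>d3\<bar> \<le> 1" "\<bar>d2\<bar> \<le> \<bar>d1\<bar>" "\<bar>d3\<bar> \<le> \<bar>d1\<bar>"
    and t: "t = 1 \<or> t = -1" "d1 = t * \<bar>d1\<bar>"
    and near: "\<bar>d1 - a1\<bar> + \<bar>d2 - a2\<bar> + \<bar>d3 - a3\<bar> < 5 / 3"
    and even: "even (a1 + a2 + a3)"
  shows "\<bar>a1 - t\<bar> + \<bar>a2\<bar> + \<bar>a3\<bar> = 1"
proof -
  have "real_of_int (\<bar>a1\<bar> + \<bar>a2\<bar> + \<bar>a3\<bar>) < 3"
    using assms(1) near by linarith
  then have "\<bar>a1\<bar> + \<bar>a2\<bar> + \<bar>a3\<bar> < 3" by linarith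
  moreover have "even (\<bar>a1\<bar> + \<bar>a2\<bar> + \<bar>a3\<bar>)" using even by simp
  ultimately consider "\<bar>a1\<bar> + \<bar>a2\<bar> + \<bar>a3\<bar> = 0" | "\<bar>a1\<bar> + \<bar>a2\<bar> + \<bar>a3\<bar> = 2"
    by (cases "\<bar>a1\<bar> + \<bar>a2\<bar> + \<bar>a3\<bar> = 1") (force, linarith)
  then show ?thesis
  proof cases
    case 1
    then have "a1 = 0" "a2 = 0" "a3 = 0" by linarith+
    then show ?thesis using t by auto
  next
    case 2
    have "t * a1 > 0"
    proof (rule ccontr)
      assume "\<not> t * a1 > 0"
      then have "\<bar>d1 - a1\<bar> = \<bar>d1\<bar> + \<bar>a1\<bar>" using t by auto
      moreover have "\<bar>d2 - a2\<bar> \<ge> \<bar>a2\<bar> - \<bar>d2\<bar>" "\<bar>d3 - a3\<bar> \<ge> \<bar>a3\<bar> - \<bar>d3\<bar>" by linarith+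
      moreover have "real_of_int \<bar>a1\<bar> + real_of_int \<bar>a2\<bar> + real_of_int \<bar>a3\<bar> = 2"
        using 2 by (simp flip: of_int_add)
      ultimately show False using near assms(1-3) by linarith
    qed
    then have "\<bar>a1 - t\<bar> = \<bar>a1\<bar> - 1" using t by auto
    then show ?thesis using 2 by linarith
  qed
qed

text \<open>The point \<open>q\<close> is the unit step along a coordinate of \<open>d\<close> of
  largest modulus, in the direction of its sign. The three cases only permute the axes.\<close>

lemma neighbour_hub:
  fixes d :: "3 \<Rightarrow> real"
  assumes "(\<Sum>k\<in>UNIV. \<bar>d k\<bar>) \<le> 1"
  obtains q :: "3 \<Rightarrow> int" where
    "\<And>a :: 3 \<Rightarrow> int. (\<Sum>k\<in>UNIV. \<bar>d k - of_int (a k)\<bar>) < 5 / 3 \<Longrightarrow> even (\<Sum>k\<in>UNIV. a k) \<Longrightarrow>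
      (\<Sum>k\<in>UNIV. \<bar>a k - q k\<bar>) = 1"
proof -
  obtain i where i: "\<And>k. \<bar>d k\<bar> \<le> \<bar>d i\<bar>"
  proof -
    have "Max (range (\<lambda>k. \<bar>d k\<bar>)) \<in> range (\<lambda>k. \<bar>d k\<bar>)" by (rule Max_in) auto
    then obtain i where "Max (range (\<lambda>k. \<bar>d k\<bar>)) = \<bar>d i\<bar>" by blast
    then have "\<bar>d k\<bar> \<le> \<bar>d i\<bar>" for k
      using Max_ge[of "range (\<lambda>k. \<bar>d k\<bar>)" "\<bar>d k\<bar>"] by simp
    then show thesis by (rule that)
  qed
  define t :: int where "t = (if d i \<ge> 0 then 1 else -1)"
  have t: "t = 1 \<or> t = -1" "d i = t * \<bar>d i\<bar>" by (auto simp: t_def)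
  show thesis
  proof (rule that[of "\<lambda>k. if k = i then t else 0"])
    fix a :: "3 \<Rightarrow> int"
    assume a: "(\<Sum>k\<in>UNIV. \<bar>d k - of_int (a k)\<bar>) < 5 / 3" "even (\<Sum>k\<in>UNIV. a k)"
    show "(\<Sum>k\<in>UNIV. \<bar>a k - (if k = i then t else 0)\<bar>) = 1"
      using exhaust_3[of i]
    proof (elim disjE)
      assume eq: "i = 1"
      have "\<bar>a 1 - t\<bar> + \<bar>a 2\<bar> + \<bar>a 3\<bar> = 1"
      proof (rule neighbour_arith[OF _ i[of 2, unfolded eq] i[of 3, unfolded eq] t[unfolded eq]])
        show "\<bar>d 1\<bar> + \<bar>d 2\<bar> + \<bar>d 3\<bar> \<le> 1"
          "\<bar>d 1 - a 1\<bar> + \<bar>d 2 - a 2\<bar> + \<bar>d 3 - a 3\<bar> < 5 / 3" "even (a 1 + a 2 + a 3)"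
          using assms a by (simp_all only: sum_3 ac_simps)
      qed
      then show ?thesis by (simp add: sum_3 eq)
    next
      assume eq: "i = 2"
      have "\<bar>a 2 - t\<bar> + \<bar>a 1\<bar> + \<bar>a 3\<bar> = 1"
      proof (rule neighbour_arith[OF _ i[of 1, unfolded eq] i[of 3, unfolded eq] t[unfolded eq]])
        show "\<bar>d 2\<bar> + \<bar>d 1\<bar> + \<bar>d 3\<bar> \<le> 1"
          "\<bar>d 2 - a 2\<bar> + \<bar>d 1 - a 1\<bar> + \<bar>d 3 - a 3\<bar> < 5 / 3" "even (a 2 + a 1 + a 3)"
          using assms a by (simp_all only: sum_3 ac_simps)
      qed
      then show ?thesis by (simp add: sum_3 eq)
    next
      assume eq: "i = 3"
      have "\<bar>a 3 - t\<bar> + \<bar>a 1\<bar> + \<bar>a 2\<bar> = 1"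
      proof (rule neighbour_arith[OF _ i[of 1, unfolded eq] i[of 2, unfolded eq] t[unfolded eq]])
        show "\<bar>d 3\<bar> + \<bar>d 1\<bar> + \<bar>d 2\<bar> \<le> 1"
          "\<bar>d 3 - a 3\<bar> + \<bar>d 1 - a 1\<bar> + \<bar>d 2 - a 2\<bar> < 5 / 3" "even (a 3 + a 1 + a 2)"
          using assms a by (simp_all only: sum_3 ac_simps)
      qed
      then show ?thesis by (simp add: sum_3 eq)
    qed
  qed
qed

text \<open>Level-5 words whose cells matter for \<open>U\<close> are mapped injectively to level-4
  words by doubling and translating; comparing the averages over \<open>6 ^ 5\<close> and
  \<open>6 ^ 4\<close> words gives the factor 6.\<close>

lemma small_set_enlarge:
  assumes M: "cube.self_similar M" and U: "closed U"
    and small: "\<And>x y. x \<in> U \<Longrightarrow> y \<in> U \<Longrightarrow> (\<Sum>k\<in>UNIV. \<bar>x $ k - y $ k\<bar>) < 1 / 48"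
  shows "\<exists>c. 6 * measure M U \<le> measure M ((\<lambda>x. c + 2 *\<^sub>R x) ` U)"
proof -
  interpret prob_space M using M by (rule cube.self_similar_prob)
  note sets = cube.self_similar_borel[OF M]
  \<comment> \<open>All other words contribute null sets, since \<open>tetra\<close> has full
    measure.\<close>
  define A where "A = {v \<in> cube.wds 5. cube.fw v -` U \<inter> tetra \<noteq> {}}"
  have null: "measure M (cube.fw v -` U) = 0" if "v \<in> cube.wds 5 - A" for v
  proof -
    have b: "cube.fw v -` U \<in> sets M"
      using cube.vimage_fw_borel[of v 5 U] that U sets by simp
    have "measure M (cube.fw v -` U) \<le> measure M (space M - tetra)"
      using that b closed_tetra sets sets.sets_into_space[OF b]
      by (intro finite_measure_mono) (auto simp: A_def)
    also have "\<dots> = 0"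
      using closed_tetra sets by (subst prob_compl) (simp_all add: self_similar_tetra[OF M])
    finally show ?thesis by (simp add: measure_le_0_iff)
  qed
  have finA: "finite A" and A5: "A \<subseteq> cube.wds 5" by (auto simp: A_def)
  have lenA: "length v = 5" if "v \<in> A" for v using that by (simp add: A_def cube.wds_def)
  have sumA: "(\<Sum>v\<in>cube.wds 5. measure M (cube.fw v -` U)) = (\<Sum>v\<in>A. measure M (cube.fw v -` U))"
    using null A5 by (intro sum.mono_neutral_right) auto
  show ?thesis
  proof (cases "A = {}")
    case True
    then have "measure M U = 0"
      using cube.self_similar_iterate[OF M, of U 5] U sumA by simp
    then show ?thesis by simp
  next
    case False
    then obtain v0 x0 where v0: "v0 \<in> cube.wds 5" "x0 \<in> tetra" "cube.fw v0 x0 \<in> U"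
      by (auto simp: A_def)
    have coord: "32 * cube.fw v x $ k = of_int (apx v k) + of_int (sg v k) * x $ k"
      if "v \<in> cube.wds 5" for v x k
      using that by (simp add: fw_cube cube.wds_def)
    have tet: "(\<Sum>k\<in>UNIV. \<bar>of_int (sg v k) * x $ k\<bar>) \<le> 1" if "x \<in> tetra" for v x
    proof -
      have "\<bar>of_int (sg v k) * x $ k\<bar> = x $ k" for k
        using that sg_cases[of v k] by (auto simp: tetra_def abs_mult)
      then show ?thesis using that by (simp add: tetra_def)
    qed
    \<comment> \<open>The common adjacent lattice point is \<open>apx v0 + q\<close>; here
      \<open>a\<close> will be the difference of two apexes, whose coordinate sum is even.\<close>
    obtain q where q: "\<And>a :: 3 \<Rightarrow> int.
        (\<Sum>k\<in>UNIV. \<bar>of_int (sg v0 k) * x0 $ k - of_int (a k)\<bar>) < 5 / 3 \<Longrightarrow>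
        even (\<Sum>k\<in>UNIV. a k) \<Longrightarrow> (\<Sum>k\<in>UNIV. \<bar>a k - q k\<bar>) = 1"
      by (rule neighbour_hub[OF tet[OF v0(2), of v0]]) blast
    define hub :: "3 \<Rightarrow> int" where "hub k = (if k = 1 then 8 else if k = 2 then 4 else 2)" for k
    have ex: "\<exists>w. length w = 4 \<and> apx w = (\<lambda>k. hub k + (apx v k - apx v0 k - q k)) \<and> sg w = sg v"
      if v: "v \<in> A" for v
    proof (rule cells_around_hub)
      obtain x where x: "x \<in> tetra" "cube.fw v x \<in> U" using v by (auto simp: A_def)
      have v5: "v \<in> cube.wds 5" using v A5 by blast
      have "\<bar>of_int (sg v0 k) * x0 $ k - of_int (apx v k - apx v0 k)\<bar>
          \<le> 32 * \<bar>cube.fw v0 x0 $ k - cube.fw v x $ k\<bar> + \<bar>of_int (sg v k) * x $ k\<bar>" for k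
      proof -
        have "\<bar>s - (p' - p)\<bar> \<le> 32 * \<bar>y - y'\<bar> + \<bar>s'\<bar>" if "32 * y = p + s" "32 * y' = p' + s'"
          for s s' p p' y y' :: real
        proof -
          have eq: "s - (p' - p) = 32 * (y - y') + s'" using that by (simp add: algebra_simps)
          show ?thesis
            using abs_triangle_ineq[of "32 * (y - y')" s'] unfolding eq by (simp only: abs_mult abs_numeral)
        qed
        from this[OF coord[OF v0(1), of x0 k] coord[OF v5, of x k]] show ?thesis
          by (simp only: of_int_diff)
      qed
      then have "(\<Sum>k\<in>UNIV. \<bar>of_int (sg v0 k) * x0 $ k - of_int (apx v k - apx v0 k)\<bar>)
          \<le> (\<Sum>k\<in>UNIV. 32 * \<bar>cube.fw v0 x0 $ k - cube.fw v x $ k\<bar> + \<bar>of_int (sg v k) * x $ k\<bar>)"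
        by (rule sum_mono)
      also have "\<dots> = 32 * (\<Sum>k\<in>UNIV. \<bar>cube.fw v0 x0 $ k - cube.fw v x $ k\<bar>)
          + (\<Sum>k\<in>UNIV. \<bar>of_int (sg v k) * x $ k\<bar>)"
        by (simp only: sum.distrib sum_distrib_left)
      \<comment> \<open>\<open>32 / 48 = 2 / 3\<close> from the size of \<open>U\<close>, plus 1
        from the position inside the cell of \<open>v\<close>.\<close>
      also have "\<dots> < 5 / 3"
        using small[OF v0(3) x(2)] tet[OF x(1), of v] by linarith
      finally have near: "(\<Sum>k\<in>UNIV. \<bar>of_int (sg v0 k) * x0 $ k - of_int (apx v k - apx v0 k)\<bar>) < 5 / 3" .
      have "v \<noteq> []" "v0 \<noteq> []" using v5 v0(1) by (auto simp: cube.wds_def)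
      then have "even (\<Sum>k\<in>UNIV. apx v k - apx v0 k)"
        using odd_sum_apx by (simp add: sum_subtractf)
      from q[OF near this] show "(\<Sum>k\<in>UNIV. \<bar>apx v k - apx v0 k - q k\<bar>) = 1" .
    qed (rule sg_cases, simp_all add: hub_def)
    define \<phi> where "\<phi> v = (SOME w. length w = 4 \<and>
        apx w = (\<lambda>k. hub k + (apx v k - apx v0 k - q k)) \<and> sg w = sg v)" for v
    have \<phi>: "\<And>v. v \<in> A \<Longrightarrow> length (\<phi> v) = 4"
        "\<And>v. v \<in> A \<Longrightarrow> apx (\<phi> v) = (\<lambda>k. hub k + (apx v k - apx v0 k - q k))"
        "\<And>v. v \<in> A \<Longrightarrow> sg (\<phi> v) = sg v"
      using someI_ex[OF ex] unfolding \<phi>_def by simp_all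
    have inj: "inj_on \<phi> A"
    proof (rule inj_onI)
      fix v w assume vw: "v \<in> A" "w \<in> A" "\<phi> v = \<phi> w"
      then have "(\<lambda>k. hub k + (apx v k - apx v0 k - q k)) = (\<lambda>k. hub k + (apx w k - apx v0 k - q k))"
        using \<phi>(2) by metis
      then have "apx v = apx w" by (simp add: fun_eq_iff)
      moreover have "sg v = sg w" using vw \<phi>(3) by metis
      ultimately show "v = w" using vw lenA by (intro cell_code_inj) simp_all
    qed
    \<comment> \<open>Doubling turns mesh \<open>1 / 32\<close> into mesh \<open>1 / 16\<close> and
      keeps lattice coordinates; the translation then takes \<open>apx v0 + q\<close> to
      \<open>hub\<close>.\<close>
    define c :: "real^3" where "c = (\<chi> k. of_int (hub k - apx v0 k - q k) / 16)"
    let ?T = "\<lambda>x. c + 2 *\<^sub>R x"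
    have "closed ((+) c ` ((*\<^sub>R) 2 ` U))" using U by (intro closed_translation closed_scaling)
    then have TU: "closed (?T ` U)" by (simp add: image_image)
    have sub: "measure M (cube.fw v -` U) \<le> measure M (cube.fw (\<phi> v) -` (?T ` U))" if v: "v \<in> A" for v
    proof (rule finite_measure_mono)
      have "cube.fw (\<phi> v) x = ?T (cube.fw v x)" for x
      proof -
        have "cube.fw (\<phi> v) x $ k = ?T (cube.fw v x) $ k" for k
          using lenA[OF v] \<phi>[OF v] by (simp add: fw_cube c_def field_simps)
        then show ?thesis by (simp add: vec_eq_iff)
      qed
      then show "cube.fw v -` U \<subseteq> cube.fw (\<phi> v) -` (?T ` U)" by auto
      show "cube.fw (\<phi> v) -` (?T ` U) \<in> sets M"
        using cube.vimage_fw_borel[of "\<phi> v" 4 "?T ` U"] TU \<phi>(1)[OF v] sets by (simp add: cube.wds_def)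
    qed
    have "(\<Sum>v\<in>A. measure M (cube.fw v -` U)) \<le> (\<Sum>v\<in>A. measure M (cube.fw (\<phi> v) -` (?T ` U)))"
      using sub by (rule sum_mono)
    also have "\<dots> = (\<Sum>w\<in>\<phi> ` A. measure M (cube.fw w -` (?T ` U)))"
      using inj by (simp add: sum.reindex)
    also have "\<dots> \<le> (\<Sum>w\<in>cube.wds 4. measure M (cube.fw w -` (?T ` U)))"
    proof (rule sum_mono2)
      show "\<phi> ` A \<subseteq> cube.wds 4" using \<phi>(1) by (auto simp: cube.wds_def)
    qed simp_all
    finally have "measure M U * 6 ^ 5 \<le> measure M (?T ` U) * 6 ^ 4"
      using cube.self_similar_iterate[OF M, of U 5] cube.self_similar_iterate[OF M, of "?T ` U" 4] U TU sumA
      by simp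
    then have "6 * measure M U \<le> measure M (?T ` U)" by simp
    then show ?thesis by blast
  qed
qed

section \<open>Comparison with the maps of the Koch surface\<close>

definition perm :: "(3 \<Rightarrow> 3) \<Rightarrow> real^3 \<Rightarrow> real^3" where
  "perm \<rho> x = (\<chi> k. x $ \<rho> k)"

lemma continuous_perm: "continuous_on A (perm \<rho>)"
  unfolding perm_def by (intro continuous_intros)

lemma perm_borel: "A \<in> sets borel \<Longrightarrow> perm \<rho> -` A \<in> sets borel"
  by (rule measurable_sets_borel[OF borel_measurable_continuous_onI[OF continuous_perm]])

lemma perm_G:
  assumes "\<And>k. \<rho> (\<rho> k) = k"
  shows "perm \<rho> (G a x) = G (\<rho> (fst a), snd a) (perm \<rho> x)"
proof -
  have "\<rho> k = fst a \<longleftrightarrow> k = \<rho> (fst a)" for k using assms by metis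
  then show ?thesis by (simp add: perm_def G_def vec_eq_iff)
qed

text \<open>\<open>perm \<rho>\<close> conjugates the maps \<open>G a\<close> into one another, so
  the image measure is again self-similar, and uniqueness applies.\<close>

lemma self_similar_perm:
  assumes M: "cube.self_similar M" and \<rho>: "\<And>k. \<rho> (\<rho> k) = k" and A: "A \<in> sets borel"
  shows "emeasure M (perm \<rho> -` A) = emeasure M A"
proof -
  interpret prob_space M using M by (rule cube.self_similar_prob)
  note sets = cube.self_similar_borel[OF M]
  have sp: "space M = UNIV" using sets_eq_imp_space_eq[OF sets] by simp
  have meas: "perm \<rho> \<in> measurable M borel"
    using borel_measurable_continuous_onI[OF continuous_perm, of \<rho>]
    by (simp add: measurable_cong_sets[OF sets refl])
  define N where "N = distr M borel (perm \<rho>)"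
  have N: "emeasure N B = emeasure M (perm \<rho> -` B)" if "B \<in> sets borel" for B
    unfolding N_def using meas that by (simp add: emeasure_distr sp)
  have "cube.self_similar N"
    unfolding cube.self_similar_def
  proof (intro conjI ballI)
    show "sets N = sets borel" by (simp add: N_def)
    show "prob_space N" unfolding N_def using meas by (rule prob_space_distr)
    fix B :: "(real^3) set" assume B: "B \<in> sets borel"
    let ?\<sigma> = "\<lambda>a::3 \<times> bool. (\<rho> (fst a), snd a)"
    have bij: "bij ?\<sigma>"
      by (rule o_bij[where g = ?\<sigma>]) (auto simp: \<rho> fun_eq_iff)
    have "emeasure M (G a -` (perm \<rho> -` B)) = emeasure N (G (?\<sigma> a) -` B)" for a
      using N[OF cube.vimage_f_borel[OF UNIV_I B]] by (simp add: vimage_def perm_G[OF \<rho>])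
    then have "(\<Sum>a\<in>UNIV. emeasure M (G a -` (perm \<rho> -` B))) = (\<Sum>a\<in>UNIV. emeasure N (G a -` B))"
      using sum.reindex_bij_betw[OF bij, of "\<lambda>a. emeasure N (G a -` B)"] by simp
    then show "emeasure N B = (\<Sum>a\<in>UNIV. emeasure N (G a -` B)) / of_nat (card (UNIV :: (3 \<times> bool) set))"
      using M perm_borel[OF B] N[OF B] by (simp add: cube.self_similar_def)
  qed
  then have "N = M" using cube.self_similar_unique M by blast
  then show ?thesis using N[OF A] by simp
qed

text \<open>The vertices of the triangle \<open>T\<close> spanned by the fixed points of \<open>KF1\<close>, \<open>KF2\<close>, \<open>KF3\<close>
  together with the apex \<open>(0, 0, sqrt 6 / 6)\<close> form the corner of a cube; \<open>\<Phi>\<close> maps the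
  origin to the apex and the unit vectors to the vertices of \<open>T\<close>.\<close>

definition \<Phi> :: "real^3 \<Rightarrow> pt" where
  "\<Phi> x = vector [sqrt 3 / 3 * x$1 - sqrt 3 / 6 * x$2 - sqrt 3 / 6 * x$3,
     (x$2 - x$3) / 2, sqrt 6 / 6 * (1 - x$1 - x$2 - x$3)]"

lemma dist_vec3: "dist (x :: real^3) y = sqrt ((x$1 - y$1)\<^sup>2 + (x$2 - y$2)\<^sup>2 + (x$3 - y$3)\<^sup>2)"
  by (simp add: dist_vec_def L2_set_def sum_3 dist_real_def)

lemma dist_Phi: "dist (\<Phi> x) (\<Phi> y) = dist x y / sqrt 2"
proof -
  define a b c where "a = x$1 - y$1" and "b = x$2 - y$2" and "c = x$3 - y$3"
  have [simp]: "sqrt 3 * sqrt 3 = (3::real)" "sqrt 6 * sqrt 6 = (6::real)" by simp_all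
  have "(\<Phi> x $ 1 - \<Phi> y $ 1)\<^sup>2 + (\<Phi> x $ 2 - \<Phi> y $ 2)\<^sup>2 + (\<Phi> x $ 3 - \<Phi> y $ 3)\<^sup>2
      = (sqrt 3 / 3 * a - sqrt 3 / 6 * b - sqrt 3 / 6 * c)\<^sup>2 + ((b - c) / 2)\<^sup>2 + (sqrt 6 / 6 * (- a - b - c))\<^sup>2"
    by (simp add: \<Phi>_def vector_3 a_def b_def c_def algebra_simps diff_divide_distrib add_divide_distrib)
  also have "\<dots> = (sqrt 3)\<^sup>2 * (a / 3 - b / 6 - c / 6)\<^sup>2 + ((b - c) / 2)\<^sup>2 + (sqrt 6)\<^sup>2 * ((- a - b - c) / 6)\<^sup>2"
  proof -
    have "sqrt 3 / 3 * a - sqrt 3 / 6 * b - sqrt 3 / 6 * c = sqrt 3 * (a / 3 - b / 6 - c / 6)"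
      "sqrt 6 / 6 * (- a - b - c) = sqrt 6 * ((- a - b - c) / 6)"
      by (simp_all add: algebra_simps)
    then show ?thesis by (simp only: power_mult_distrib)
  qed
  also have "\<dots> = (a\<^sup>2 + b\<^sup>2 + c\<^sup>2) / 2"
    by (simp add: power2_eq_square field_simps)
  finally show ?thesis
    by (simp only: dist_vec3 real_sqrt_divide a_def b_def c_def)
qed

lemma continuous_Phi: "continuous_on A \<Phi>"
proof -
  have "(1 / sqrt 2)-lipschitz_on A \<Phi>"
    by (intro lipschitz_onI) (simp_all add: dist_Phi)
  then show ?thesis by (rule lipschitz_on_continuous_on)
qed

lemma trig_values:
  "cos (2 * pi / 3) = - (1 / 2)" "sin (2 * pi / 3) = sqrt 3 / 2"
  "cos (4 * pi / 3) = - (1 / 2)" "sin (4 * pi / 3) = - (sqrt 3 / 2)"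
proof -
  show 1: "cos (2 * pi / 3) = - (1 / 2)" "sin (2 * pi / 3) = sqrt 3 / 2"
    by (simp_all add: cos_120 sin_120 cos_120' sin_120')
  have "4 * pi / 3 = pi + pi / 3" by simp
  then show "cos (4 * pi / 3) = - (1 / 2)" "sin (4 * pi / 3) = - (sqrt 3 / 2)"
    by (simp_all only: cos_add sin_add) (simp_all add: cos_60 sin_60)
qed

lemma KF2_eq: "KF2 p = vector [(p$1 - sqrt 3 / 6) / 2, (p$2 + 1 / 2) / 2, p$3 / 2]"
  and KF3_eq: "KF3 p = vector [(p$1 - sqrt 3 / 6) / 2, (p$2 - 1 / 2) / 2, p$3 / 2]"
proof -
  have "sqrt 3 / 3 * (sqrt 3 / 2) = (1 / 2 :: real)" by simp
  then show "KF2 p = vector [(p$1 - sqrt 3 / 6) / 2, (p$2 + 1 / 2) / 2, p$3 / 2]"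
      "KF3 p = vector [(p$1 - sqrt 3 / 6) / 2, (p$2 - 1 / 2) / 2, p$3 / 2]"
    unfolding KF2_def KF3_def trig_values by simp_all
qed

text \<open>In cube coordinates \<open>KF j\<close> is \<open>G (letter j)\<close> after the coordinate transposition \<open>swap j\<close>;
  the attractor and the self-similar measure of \<open>G\<close> are symmetric under these.\<close>

definition swap :: "nat \<Rightarrow> 3 \<Rightarrow> 3" where
  "swap j k = (if j = 4 then (if k = 2 then 3 else if k = 3 then 2 else k)
     else if j = 5 then (if k = 1 then 2 else if k = 2 then 1 else k)
     else if j = 6 then (if k = 1 then 3 else if k = 3 then 1 else k) else k)"

definition letter :: "nat \<Rightarrow> 3 \<times> bool" where
  "letter j = (if j = 1 then (1, True) else if j = 2 then (2, True) else if j = 3 then (3, True)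
     else if j = 4 then (1, False) else if j = 5 then (2, False) else (3, False))"

lemma swap_swap: "swap j (swap j k) = k"
  by (simp add: swap_def)

lemma atLeast1_atMost6: "{1..6::nat} = {1, 2, 3, 4, 5, 6}"
  by auto

lemma bij_letter: "bij_betw letter {1..6} UNIV"
proof -
  have "a \<in> letter ` {1..6}" for a
    using exhaust_3[of "fst a"] unfolding atLeast1_atMost6
    by (cases a; cases "snd a") (auto simp: letter_def)
  then have "letter ` {1..6} = UNIV" by blast
  moreover have "inj_on letter {1..6}"
    using \<open>letter ` {1..6} = UNIV\<close> by (intro eq_card_imp_inj_on) simp_all
  ultimately show ?thesis by (simp add: bij_betw_def)
qed

lemma KF_Phi:
  assumes "j \<in> {1..6}"
  shows "KF j (\<Phi> x) = \<Phi> (G (letter j) (perm (swap j) x))"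
proof -
  have r: "sqrt 2 * sqrt 6 = 2 * sqrt (3::real)" "sqrt 2 * sqrt 3 = sqrt (6::real)"
    "sqrt 3 * sqrt 3 = (3::real)" "sqrt 6 * sqrt 6 = (6::real)"
    using real_sqrt_mult[of 4 3] by (simp_all flip: real_sqrt_mult)
  \<comment> \<open>Variants with further factors, so that products of roots are found however
    \<open>field_simps\<close> arranges them.\<close>
  have [simp]: "sqrt 2 * (sqrt 6 * u) = 2 * (sqrt 3 * u)" "sqrt 2 * (sqrt 3 * u) = sqrt 6 * u"
    "sqrt 3 * (sqrt 3 * u) = 3 * u" "sqrt 6 * (sqrt 6 * u) = 6 * u" for u :: real
    by (simp_all add: r flip: mult.assoc)
  have [simp]: "sqrt 2 * (v * (sqrt 6 * u)) = v * (2 * (sqrt 3 * u))" "sqrt 2 * (v * (sqrt 3 * u)) = v * (sqrt 6 * u)"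
    "sqrt 3 * (v * (sqrt 3 * u)) = v * (3 * u)" "sqrt 6 * (v * (sqrt 6 * u)) = v * (6 * u)" for u v :: real
    by (simp_all add: mult.left_commute[of _ v])
  note [simp] = r
  from assms have "j = 1 \<or> j = 2 \<or> j = 3 \<or> j = 4 \<or> j = 5 \<or> j = 6" by auto
  then show ?thesis
  proof (elim disjE)
    assume j: "j = 1"
    show ?thesis unfolding j
      by (simp add: KF_def KF1_def letter_def swap_def perm_def G_def \<Phi>_def vec_eq_iff forall_3 vector_3 field_simps)
  next
    assume j: "j = 2"
    show ?thesis unfolding j
      by (simp add: KF_def KF2_eq letter_def swap_def perm_def G_def \<Phi>_def vec_eq_iff forall_3 vector_3 field_simps)
  next
    assume j: "j = 3"
    show ?thesis unfolding j
      by (simp add: KF_def KF3_eq letter_def swap_def perm_def G_def \<Phi>_def vec_eq_iff forall_3 vector_3 field_simps)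
  next
    assume j: "j = 4"
    show ?thesis unfolding j
      by (simp add: KF_def KF4_def letter_def swap_def perm_def G_def \<Phi>_def vec_eq_iff forall_3 vector_3 field_simps)
  next
    assume j: "j = 5"
    show ?thesis unfolding j
      by (simp add: KF_def KF5_def letter_def swap_def perm_def G_def \<Phi>_def vec_eq_iff forall_3 vector_3 field_simps)
  next
    assume j: "j = 6"
    show ?thesis unfolding j
      by (simp add: KF_def KF6_def letter_def swap_def perm_def G_def \<Phi>_def vec_eq_iff forall_3 vector_3 field_simps)
  qed
qed

text \<open>The inverse of \<open>\<Phi>\<close>: \<open>s\<close> recovers the sum of the three
  cube coordinates from the height.\<close>

definition \<Psi> :: "pt \<Rightarrow> real^3" where
  "\<Psi> p = (let s = 1 - sqrt 6 * p$3; r2 = (s - sqrt 3 * p$1) / 3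
     in vector [(s + 2 * sqrt 3 * p$1) / 3, r2 + p$2, r2 - p$2])"

lemma Phi_Psi: "\<Phi> (\<Psi> p) = p"
proof -
  have [simp]: "sqrt 3 * (sqrt 3 * u) = 3 * u" "sqrt 6 * (sqrt 6 * u) = 6 * u" for u :: real
    by (simp_all flip: mult.assoc)
  show ?thesis
    by (simp add: \<Phi>_def \<Psi>_def Let_def vec_eq_iff forall_3 vector_3 field_simps)
qed

text \<open>Both sides have the same image under \<open>\<Phi>\<close>, which is injective by
  \<open>dist_Phi\<close>.\<close>

lemma Psi_Phi: "\<Psi> (\<Phi> x) = x"
proof -
  have "dist (\<Psi> (\<Phi> x)) x = 0"
    using dist_Phi[of "\<Psi> (\<Phi> x)" x] by (simp add: Phi_Psi)
  then show ?thesis by simp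
qed

lemma dist_Psi: "dist (\<Psi> p) (\<Psi> q) = sqrt 2 * dist p q"
  using dist_Phi[of "\<Psi> p" "\<Psi> q"] by (simp add: Phi_Psi)

lemma continuous_Psi: "continuous_on A \<Psi>"
proof -
  have "(sqrt 2)-lipschitz_on A \<Psi>"
    by (intro lipschitz_onI) (simp_all add: dist_Psi)
  then show ?thesis by (rule lipschitz_on_continuous_on)
qed

lemma Phi_image_eq_vimage: "\<Phi> ` A = \<Psi> -` A"
  by (auto simp: Psi_Phi) (metis Phi_Psi imageI)

lemma closed_Phi_image: "closed A \<Longrightarrow> closed (\<Phi> ` A)"
  unfolding Phi_image_eq_vimage by (intro closed_vimage continuous_Psi)

lemma closed_Phi_vimage: "closed A \<Longrightarrow> closed (\<Phi> -` A)"
  by (intro closed_vimage continuous_Phi)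

lemma Phi_vimage_image: "\<Phi> -` (\<Phi> ` A) = A"
  by (auto simp: Phi_image_eq_vimage Psi_Phi)

lemma sum_involution:
  fixes g :: "3 \<Rightarrow> real"
  assumes "\<And>k. \<rho> (\<rho> k) = k"
  shows "(\<Sum>k\<in>UNIV. g (\<rho> k)) = (\<Sum>k\<in>UNIV. g k)"
  by (rule sum.reindex_bij_betw, rule o_bij[where g = \<rho>]) (auto simp: assms fun_eq_iff)

lemma dist_perm: "(\<And>k. \<rho> (\<rho> k) = k) \<Longrightarrow> dist (perm \<rho> x) (perm \<rho> y) = dist x y"
  using sum_involution[of \<rho> "\<lambda>k. (dist (x $ k) (y $ k))\<^sup>2"]
  by (simp add: dist_vec_def L2_set_def perm_def)

lemma perm_tetra: "(\<And>k. \<rho> (\<rho> k) = k) \<Longrightarrow> x \<in> tetra \<Longrightarrow> perm \<rho> x \<in> tetra"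
  using sum_involution[of \<rho> "\<lambda>k. x $ k"] by (simp add: tetra_def perm_def)

section \<open>The Koch surface and its measure as images of the cube model\<close>

declare One_nat_def [simp del]

interpretation koch: half_ifs "{1..6::nat}" KF
proof
  fix j :: nat and x y :: pt
  assume j: "j \<in> {1..6}"
  have "dist (KF j (\<Phi> (\<Psi> x))) (KF j (\<Phi> (\<Psi> y))) = dist (\<Psi> x) (\<Psi> y) / 2 / sqrt 2"
    unfolding KF_Phi[OF j] dist_Phi by (simp add: cube.dist_f dist_perm swap_swap)
  then show "dist (KF j x) (KF j y) = dist x y / 2"
    by (simp add: Phi_Psi dist_Psi)
qed auto

lemma Fword_eq: "Fword w = koch.fw w"
  by (induction w) simp_all

lemma ncells_eq: "ncells n = (\<lambda>w. koch.fw w ` K2) ` koch.wds n"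
  by (auto simp: ncells_def Fword_eq koch.wds_def)

lemma attractor_K2: "koch.attractor K2"
proof -
  have "K2 = (THE K. koch.attractor K)"
    by (simp add: K2_def koch.attractor_def)
  moreover have "koch.attractor (THE K. koch.attractor K)"
    using koch.attractor_exists koch.attractor_unique by (metis theI')
  ultimately show ?thesis by simp
qed

text \<open>The transposition between \<open>KF j\<close> and \<open>G (letter j)\<close> disappears
  by \<open>self_similar_perm\<close>, and \<open>letter\<close> matches the two index sets.\<close>

lemma self_similar_distr_Phi:
  assumes M: "cube.self_similar M"
  shows "koch.self_similar (distr M borel \<Phi>)"
proof -
  interpret prob_space M using M by (rule cube.self_similar_prob)
  note sets = cube.self_similar_borel[OF M]
  have sp: "space M = UNIV" using sets_eq_imp_space_eq[OF sets] by simp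
  have meas: "\<Phi> \<in> measurable M borel"
    using borel_measurable_continuous_onI[OF continuous_Phi]
    by (simp add: measurable_cong_sets[OF sets refl])
  have vim: "\<Phi> -` A \<in> sets borel" if "A \<in> sets borel" for A
    by (rule measurable_sets_borel[OF borel_measurable_continuous_onI[OF continuous_Phi] that])
  define N where "N = distr M borel \<Phi>"
  have N: "emeasure N A = emeasure M (\<Phi> -` A)" if "A \<in> sets borel" for A
    unfolding N_def using meas that by (simp add: emeasure_distr sp)
  have "koch.self_similar N"
    unfolding koch.self_similar_def
  proof (intro conjI ballI)
    show "sets N = sets borel" by (simp add: N_def)
    show "prob_space N" unfolding N_def using meas by (rule prob_space_distr)
    fix A :: "pt set" assume A: "A \<in> sets borel"
    have "emeasure N (KF j -` A) = emeasure M (G (letter j) -` (\<Phi> -` A))" if j: "j \<in> {1..6}" for j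
    proof -
      have "emeasure N (KF j -` A) = emeasure M (\<Phi> -` (KF j -` A))"
        by (rule N[OF koch.vimage_f_borel[OF j A]])
      also have "\<Phi> -` (KF j -` A) = perm (swap j) -` (G (letter j) -` (\<Phi> -` A))"
        by (simp add: vimage_def KF_Phi[OF j])
      also have "emeasure M \<dots> = emeasure M (G (letter j) -` (\<Phi> -` A))"
        by (rule self_similar_perm[OF M swap_swap cube.vimage_f_borel[OF UNIV_I vim[OF A]]])
      finally show ?thesis .
    qed
    then have "(\<Sum>j\<in>{1..6}. emeasure N (KF j -` A)) = (\<Sum>j\<in>{1..6}. emeasure M (G (letter j) -` (\<Phi> -` A)))"
      by (intro sum.cong) auto
    also have "\<dots> = (\<Sum>a\<in>UNIV. emeasure M (G a -` (\<Phi> -` A)))"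
      by (rule sum.reindex_bij_betw[OF bij_letter])
    finally show "emeasure N A = (\<Sum>j\<in>{1..6}. emeasure N (KF j -` A)) / of_nat (card {1..6::nat})"
      using M vim[OF A] N[OF A] by (simp add: cube.self_similar_def)
  qed
  then show ?thesis by (simp add: N_def)
qed

lemma mu_eq_distr:
  obtains M where "cube.self_similar M" "mu = distr M borel \<Phi>" "koch.self_similar mu"
proof -
  obtain M where M: "cube.self_similar M"
    using self_similar_exists[OF cube.half_ifs_axioms] by blast
  note N = self_similar_distr_Phi[OF M]
  have "mu = (THE N. koch.self_similar N)"
    by (simp add: mu_def koch.self_similar_def)
  also have "\<dots> = distr M borel \<Phi>"
    by (rule the_equality, rule N, erule koch.self_similar_unique[OF _ N])
  finally show ?thesis using that M N by simp
qed

lemma self_similar_mu: "koch.self_similar mu"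
  using mu_eq_distr by blast

lemma K2_subset: "K2 \<subseteq> \<Phi> ` tetra"
proof (rule koch.attractor_subset[OF attractor_K2 closed_Phi_image[OF closed_tetra]])
  have "0 \<in> tetra" by (simp add: tetra_def)
  then show "\<Phi> ` tetra \<noteq> {}" by blast
  fix j :: nat assume j: "j \<in> {1..6}"
  have "KF j (\<Phi> x) \<in> \<Phi> ` tetra" if "x \<in> tetra" for x
    unfolding KF_Phi[OF j] using perm_tetra[of "swap j", OF swap_swap that] G_tetra[of "letter j"] by blast
  then show "KF j ` \<Phi> ` tetra \<subseteq> \<Phi> ` tetra" by blast
qed

lemma diameter_K2: "diameter K2 \<le> 1"
proof (rule diameter_le)
  fix p q assume "p \<in> K2" "q \<in> K2"
  then obtain x y where xy: "x \<in> tetra" "y \<in> tetra" "p = \<Phi> x" "q = \<Phi> y"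
    using K2_subset by blast
  \<comment> \<open>Summed over \<open>k\<close>, this bounds the squared distance in cube
    coordinates by 2, and \<open>\<Phi>\<close> divides distances by \<open>sqrt 2\<close>.\<close>
  have sq: "(x $ k - y $ k)\<^sup>2 \<le> x $ k + y $ k" for k
  proof -
    have le1: "0 \<le> z $ k" "z $ k \<le> 1" if "z \<in> tetra" for z
    proof -
      show "0 \<le> z $ k" using that by (simp add: tetra_def)
      have "z $ k \<le> (\<Sum>k\<in>UNIV. z $ k)"
        using that by (intro member_le_sum) (auto simp: tetra_def)
      then show "z $ k \<le> 1" using that by (simp add: tetra_def)
    qed
    have "(x $ k - y $ k)\<^sup>2 = x $ k * x $ k + y $ k * y $ k - 2 * (x $ k * y $ k)"
      by (simp add: power2_eq_square algebra_simps)
    moreover have "x $ k * x $ k \<le> x $ k" "y $ k * y $ k \<le> y $ k" "0 \<le> x $ k * y $ k"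
      using le1[OF xy(1)] le1[OF xy(2)] by (simp_all add: mult_left_le)
    ultimately show ?thesis by linarith
  qed
  have "(dist x y)\<^sup>2 \<le> 2"
    using sq[of 1] sq[of 2] sq[of 3] xy by (simp add: dist_vec3 tetra_def sum_3)
  then have "dist x y \<le> sqrt 2" by (rule real_le_rsqrt)
  then show "norm (p - q) \<le> 1" by (simp add: xy dist_Phi flip: dist_norm)
qed simp

lemma taxicab_le: "(\<Sum>k\<in>UNIV. \<bar>x $ k - y $ k\<bar>) \<le> sqrt 3 * dist (x :: real^3) y"
proof -
  define a b c where "a = \<bar>x$1 - y$1\<bar>" and "b = \<bar>x$2 - y$2\<bar>" and "c = \<bar>x$3 - y$3\<bar>"
  have "(a + b + c)\<^sup>2 = 3 * (a\<^sup>2 + b\<^sup>2 + c\<^sup>2) - ((a - b)\<^sup>2 + (b - c)\<^sup>2 + (a - c)\<^sup>2)"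
    by (simp add: power2_eq_square algebra_simps)
  moreover have "0 \<le> (a - b)\<^sup>2 + (b - c)\<^sup>2 + (a - c)\<^sup>2" by simp
  ultimately have "(a + b + c)\<^sup>2 \<le> 3 * (a\<^sup>2 + b\<^sup>2 + c\<^sup>2)" by linarith
  then have "a + b + c \<le> sqrt (3 * (a\<^sup>2 + b\<^sup>2 + c\<^sup>2))" by (rule real_le_rsqrt)
  then show ?thesis unfolding sum_3 dist_vec3 real_sqrt_mult by (simp add: a_def b_def c_def)
qed

section \<open>Lower bound for the Hausdorff measure\<close>

text \<open>Chosen to make \<open>2 * s2 / (2 ^ n * d0)\<close> the exponent of the theorem; the
  proof uses \<open>sqrt 6 * d0 < 1 / 48\<close>.\<close>

definition d0 :: real where
  "d0 = 1 / (32 * (sqrt 2 + sqrt 6))"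

lemma d0_pos: "d0 > 0"
  by (simp add: d0_def add_pos_pos)

lemma small_set_enlarge_mu:
  assumes V: "closed V" "bounded V" "diameter V < d0"
  shows "\<exists>W. closed W \<and> bounded W \<and> 6 * measure mu V \<le> measure mu W \<and> diameter W \<le> 2 * diameter V"
proof -
  obtain M where M: "cube.self_similar M" and mu: "mu = distr M borel \<Phi>"
    using mu_eq_distr by blast
  note sets = cube.self_similar_borel[OF M]
  have sp: "space M = UNIV" using sets_eq_imp_space_eq[OF sets] by simp
  have meas: "\<Phi> \<in> measurable M borel"
    using borel_measurable_continuous_onI[OF continuous_Phi]
    by (simp add: measurable_cong_sets[OF sets refl])
  have mu': "measure mu A = measure M (\<Phi> -` A)" if "closed A" for A
    unfolding mu using meas that by (simp add: measure_distr sp)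
  define U where "U = \<Phi> -` V"
  have U: "closed U" using V by (simp add: U_def closed_Phi_vimage)
  have "(\<Sum>k\<in>UNIV. \<bar>x $ k - y $ k\<bar>) < 1 / 48" if xy: "x \<in> U" "y \<in> U" for x y
  proof -
    have "dist (\<Phi> x) (\<Phi> y) < d0"
      using diameter_bounded_bound[OF V(2), of "\<Phi> x" "\<Phi> y"] xy V(3) by (simp add: U_def)
    then have "dist x y < sqrt 2 * d0" by (simp add: dist_Phi divide_less_eq mult.commute)
    \<comment> \<open>\<open>sqrt 3\<close> compares the taxicab with the Euclidean distance,
      \<open>sqrt 2\<close> is the ratio of \<open>\<Psi>\<close>. The bound \<open>1 / 48\<close>
      then reduces to \<open>sqrt 3 < 2\<close>.\<close>
    then have "sqrt 3 * dist x y < sqrt 3 * (sqrt 2 * d0)" by simp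
    also have "\<dots> < 1 / 48"
    proof -
      have six: "sqrt 6 = sqrt 2 * sqrt (3::real)" by (simp flip: real_sqrt_mult)
      have "sqrt 3 * (sqrt 2 * d0) = (sqrt 2 * sqrt 3) / (sqrt 2 * (32 * (1 + sqrt 3)))"
        unfolding d0_def six by (simp add: field_simps)
      also have "\<dots> = sqrt 3 / (32 * (1 + sqrt 3))" by simp
      also have "\<dots> < 1 / 48"
      proof -
        have "sqrt 3 < (2::real)" by (rule real_less_lsqrt) simp_all
        moreover have "32 * (1 + sqrt 3) > (0::real)" by (simp add: add_pos_pos)
        ultimately show ?thesis by (simp add: divide_less_eq)
      qed
      finally show ?thesis .
    qed
    finally show ?thesis using taxicab_le[of x y] by linarith
  qed
  then obtain c where c: "6 * measure M U \<le> measure M ((\<lambda>x. c + 2 *\<^sub>R x) ` U)"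
    using small_set_enlarge[OF M U] by blast
  define T where "T p = \<Phi> (c + 2 *\<^sub>R \<Psi> p)" for p
  have dT: "dist (T p) (T q) = 2 * dist p q" for p q
  proof -
    have "dist (c + 2 *\<^sub>R x) (c + 2 *\<^sub>R y) = 2 * dist x y" for x y :: "real^3"
      by (simp add: dist_norm flip: scaleR_right_diff_distrib)
    then show ?thesis by (simp only: T_def dist_Phi dist_Psi) simp
  qed
  have UV: "V = \<Phi> ` U"
    unfolding U_def Phi_image_eq_vimage by (simp add: vimage_def Phi_Psi)
  then have TV: "T ` V = \<Phi> ` ((\<lambda>x. c + 2 *\<^sub>R x) ` U)"
    by (simp add: T_def image_image Psi_Phi)
  have "closed ((+) c ` ((*\<^sub>R) 2 ` U))" using U by (intro closed_translation closed_scaling)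
  then have "closed ((\<lambda>x. c + 2 *\<^sub>R x) ` U)" by (simp add: image_image)
  then have cl: "closed (T ` V)" unfolding TV by (rule closed_Phi_image)
  moreover have "6 * measure mu V \<le> measure mu (T ` V)"
    using c mu'[OF cl] mu'[OF V(1)] by (simp add: TV Phi_vimage_image U_def)
  moreover have "bounded (T ` V)"
    using V(2) by (intro bounded_lipschitz_image[where r = 2]) (simp_all add: dT)
  moreover have "diameter (T ` V) \<le> 2 * diameter V"
    using V(2) by (intro diameter_image_le) (simp_all add: dT)
  ultimately show ?thesis by blast
qed

section \<open>The minima \<open>a_seq\<close> and the mass bound\<close>

lemma s2_pos: "s2 > 0"
  by (simp add: s2_def)

lemma two_powr_s2: "2 powr s2 = 6"
  by (simp add: s2_def powr_def)

lemma finite_ncells: "finite (ncells n)"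
  by (simp add: ncells_eq)

lemma ncells_nonempty: "ncells n \<noteq> {}"
  using koch.card_wds[of n] by (auto simp: ncells_eq)

lemma compact_ncell: "D \<in> ncells n \<Longrightarrow> compact D"
  using attractor_K2 unfolding koch.attractor_def
  by (auto simp: ncells_eq intro!: compact_continuous_image koch.continuous_fw)

lemma compact_Union_ncells: "C \<subseteq> ncells n \<Longrightarrow> compact (\<Union>C)"
  using finite_subset[OF _ finite_ncells] compact_ncell by (intro compact_Union) auto

definition ratios :: "nat \<Rightarrow> real set" where
  "ratios n = (\<lambda>C. diameter (\<Union>C) powr s2 / measure mu (\<Union>C)) ` {C. C \<subseteq> ncells n \<and> C \<noteq> {}}"

lemma a_seq_eq: "a_seq n = Min (ratios n)"
  unfolding a_seq_def ratios_def by (rule arg_cong[where f = Min]) auto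

lemma finite_ratios: "finite (ratios n)"
  unfolding ratios_def using finite_ncells by simp

lemma a_seq_le: "C \<subseteq> ncells n \<Longrightarrow> C \<noteq> {} \<Longrightarrow> a_seq n \<le> diameter (\<Union>C) powr s2 / measure mu (\<Union>C)"
  unfolding a_seq_eq by (rule Min_le[OF finite_ratios]) (auto simp: ratios_def)

lemma a_seq_attained:
  obtains C where "C \<subseteq> ncells n" "C \<noteq> {}" "a_seq n = diameter (\<Union>C) powr s2 / measure mu (\<Union>C)"
proof -
  have "ratios n \<noteq> {}" using ncells_nonempty[of n] by (auto simp: ratios_def)
  then have "a_seq n \<in> ratios n" unfolding a_seq_eq by (rule Min_in[OF finite_ratios])
  then show ?thesis using that by (auto simp: ratios_def)
qed

lemma a_seq_nonneg: "a_seq n \<ge> 0"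
  by (rule a_seq_attained[of n]) simp

text \<open>For the word of a cell in \<open>C\<close> the preimage of the union contains
  \<open>K2\<close>, so one term of the average is 1. Thus no quotient in \<open>a_seq\<close> is a
  division by zero.\<close>

lemma measure_Union_ncells_pos:
  assumes C: "C \<subseteq> ncells n" "C \<noteq> {}"
  shows "measure mu (\<Union>C) > 0"
proof -
  interpret prob_space mu using self_similar_mu by (rule koch.self_similar_prob)
  note sets = koch.self_similar_borel[OF self_similar_mu]
  obtain w where w: "w \<in> koch.wds n" "koch.fw w ` K2 \<in> C" using C by (auto simp: ncells_eq)
  have b: "\<Union>C \<in> sets borel" using compact_Union_ncells[OF C(1)] by (simp add: compact_imp_closed)
  have "1 = measure mu K2" using koch.self_similar_attractor[OF self_similar_mu attractor_K2] by simp
  also have "\<dots> \<le> measure mu (koch.fw w -` (\<Union>C))"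
    using w koch.vimage_fw_borel[OF w(1) b] sets by (intro finite_measure_mono) auto
  also have "\<dots> \<le> (\<Sum>v\<in>koch.wds n. measure mu (koch.fw v -` (\<Union>C)))"
    using w by (intro member_le_sum) auto
  also have "\<dots> = 6 ^ n * measure mu (\<Union>C)"
    using koch.self_similar_iterate[OF self_similar_mu b, of n] by simp
  finally have "0 < 6 ^ n * measure mu (\<Union>C)" by linarith
  then show ?thesis by (simp add: zero_less_mult_iff)
qed

text \<open>Passing to the touching cells adds at most \<open>2 / 2 ^ n\<close> to the diameter,
  which for diameters from \<open>d0\<close> on is a factor of at most
  \<open>exp (2 / (2 ^ n * d0))\<close>.\<close>

lemma mass_large:
  assumes V: "closed V" "bounded V" "d0 \<le> diameter V"
  shows "a_seq n * exp (- (2 * s2 / (2 ^ n * d0))) * measure mu V \<le> diameter V powr s2"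
proof -
  interpret prob_space mu using self_similar_mu by (rule koch.self_similar_prob)
  define C where "C = (\<lambda>w. koch.fw w ` K2) ` koch.touching K2 n V"
  have C: "C \<subseteq> ncells n" by (auto simp: C_def ncells_eq koch.touching_def)
  have le: "measure mu V \<le> measure mu (\<Union>C)"
    using koch.measure_le_touching[OF attractor_K2 self_similar_mu, of V n] V by (simp add: C_def)
  have "a_seq n * measure mu V \<le> diameter V powr s2 * exp (2 * s2 / (2 ^ n * d0))"
  proof (cases "C = {}")
    case True
    then have "measure mu V = 0" using le measure_nonneg[of mu V] by simp
    then show ?thesis by simp
  next
    case False
    have dp: "diameter V > 0" using V d0_pos by linarith
    have "a_seq n * measure mu V \<le> a_seq n * measure mu (\<Union>C)"
      using le a_seq_nonneg by (rule mult_left_mono)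
    also have "\<dots> \<le> diameter (\<Union>C) powr s2"
      using a_seq_le[OF C False] measure_Union_ncells_pos[OF C False] by (simp add: pos_le_divide_eq)
    also have "\<dots> \<le> (diameter V * exp (2 / (2 ^ n * d0))) powr s2"
    proof (rule powr_mono2)
      have "diameter (\<Union>C) \<le> diameter V + 2 * diameter K2 / 2 ^ n"
        using koch.diameter_touching[OF attractor_K2 V(2), of n] by (simp add: C_def)
      also have "\<dots> \<le> diameter V + 2 / 2 ^ n"
        using diameter_K2 by (simp add: divide_right_mono)
      also have "\<dots> \<le> diameter V + diameter V * (2 / (2 ^ n * d0))"
      proof -
        have "2 / 2 ^ n = d0 * (2 / (2 ^ n * d0))" using d0_pos by simp
        also have "\<dots> \<le> diameter V * (2 / (2 ^ n * d0))"
          using V(3) d0_pos by (intro mult_right_mono) simp_all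
        finally show ?thesis by simp
      qed
      also have "\<dots> = diameter V * (1 + 2 / (2 ^ n * d0))" by (simp add: distrib_left)
      also have "\<dots> \<le> diameter V * exp (2 / (2 ^ n * d0))"
        using dp by (intro mult_left_mono exp_ge_add_one_self) simp
      finally show "diameter (\<Union>C) \<le> diameter V * exp (2 / (2 ^ n * d0))" .
    qed (use s2_pos compact_Union_ncells[OF C] in \<open>simp_all add: diameter_ge_0 compact_imp_bounded\<close>)
    also have "\<dots> = diameter V powr s2 * exp (2 * s2 / (2 ^ n * d0))"
      using dp by (simp add: powr_mult) (simp add: powr_def mult.commute)
    finally show ?thesis .
  qed
  then have "a_seq n * measure mu V * exp (- (2 * s2 / (2 ^ n * d0)))
      \<le> diameter V powr s2 * exp (2 * s2 / (2 ^ n * d0)) * exp (- (2 * s2 / (2 ^ n * d0)))"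
    by (intro mult_right_mono) simp_all
  also have "\<dots> = diameter V powr s2" by (simp add: mult.assoc flip: exp_add)
  finally show ?thesis by (simp add: ac_simps)
qed

text \<open>A set of small diameter is enlarged by the factor 2 as long as it is small; its measure grows
  by the factor 6 in each step, so this stops before the measure exceeds 1.\<close>

lemma mass_bound:
  assumes V: "closed V" "bounded V"
  shows "a_seq n * exp (- (2 * s2 / (2 ^ n * d0))) * measure mu V \<le> diameter V powr s2"
proof -
  interpret prob_space mu using self_similar_mu by (rule koch.self_similar_prob)
  define b where "b = a_seq n * exp (- (2 * s2 / (2 ^ n * d0)))"
  have b0: "b \<ge> 0" using a_seq_nonneg by (simp add: b_def)
  have iter: "b * measure mu V \<le> diameter V powr s2"
    if "6 ^ k * measure mu V > 1" "closed V" "bounded V" for k V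
    using that
  proof (induction k arbitrary: V)
    case 0
    then show ?case using prob_le_1[of V] by simp
  next
    case (Suc k)
    show ?case
    proof (cases "d0 \<le> diameter V")
      case True
      then show ?thesis using mass_large Suc.prems by (simp add: b_def)
    next
      case False
      then obtain W where W: "closed W" "bounded W" "6 * measure mu V \<le> measure mu W"
          "diameter W \<le> 2 * diameter V"
        using small_set_enlarge_mu[of V] Suc.prems by auto
      have "1 < 6 ^ k * (6 * measure mu V)" using Suc.prems(1) by (simp add: ac_simps)
      also have "\<dots> \<le> 6 ^ k * measure mu W" using W(3) by (intro mult_left_mono) simp_all
      finally have IH: "b * measure mu W \<le> diameter W powr s2" using Suc.IH W by blast
      \<comment> \<open>The gain 6 in measure equals the gain \<open>2 powr s2\<close> on the other
        side, so the same \<open>b\<close> survives every doubling.\<close>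
      have "6 * (b * measure mu V) \<le> b * measure mu W"
        using mult_left_mono[OF W(3) b0] by (simp add: ac_simps)
      also note IH
      also have "diameter W powr s2 \<le> (2 * diameter V) powr s2"
        using W s2_pos by (intro powr_mono2 diameter_ge_0) simp_all
      also have "\<dots> = 6 * diameter V powr s2"
        using Suc.prems(3) by (simp add: powr_mult diameter_ge_0 two_powr_s2)
      finally show ?thesis by simp
    qed
  qed
  show ?thesis
  proof (cases "measure mu V = 0")
    case False
    then have pos: "measure mu V > 0" by (simp add: order_less_le)
    then obtain k where "1 / measure mu V < 6 ^ k" using real_arch_pow[of 6] by auto
    then have "6 ^ k * measure mu V > 1" using pos by (simp add: divide_less_eq)
    then show ?thesis using iter V unfolding b_def by blast
  qed simp
qed

theorem theorem3:
  fixes n :: nat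
  shows "ennreal (a_seq n) \<ge> hausdorff_measure s2 K2 \<and>
         hausdorff_measure s2 K2 \<ge>
           ennreal (a_seq n * exp (- (s2 * (sqrt 2 + sqrt 6) / 2 powr (real n - 6))))"
proof
  obtain C where C: "C \<subseteq> ncells n" "C \<noteq> {}" "a_seq n = diameter (\<Union>C) powr s2 / measure mu (\<Union>C)"
    by (rule a_seq_attained)
  have "compact (\<Union>C)" using C(1) by (rule compact_Union_ncells)
  then show "hausdorff_measure s2 K2 \<le> ennreal (a_seq n)"
    unfolding C(3) using measure_Union_ncells_pos[OF C(1,2)] s2_pos two_powr_s2
    by (intro koch.hausdorff_measure_le attractor_K2 self_similar_mu)
      (simp_all add: compact_imp_bounded compact_imp_closed)
next
  \<comment> \<open>The factor 64 combines 32 from the level-5 mesh in \<open>d0\<close> with 2 from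
    the cells added at both ends of a diameter.\<close>
  have "(2::real) powr (real n - 6) = 2 ^ n / 64"
    by (simp add: powr_diff powr_realpow)
  then have exponent: "s2 * (sqrt 2 + sqrt 6) / 2 powr (real n - 6) = 2 * s2 / (2 ^ n * d0)"
    by (simp only: d0_def) (simp add: field_simps)
  show "ennreal (a_seq n * exp (- (s2 * (sqrt 2 + sqrt 6) / 2 powr (real n - 6)))) \<le> hausdorff_measure s2 K2"
    unfolding exponent
  proof (rule hausdorff_measure_ge)
    show "sets mu = sets borel" by (rule koch.self_similar_borel[OF self_similar_mu])
    show "prob_space mu" by (rule koch.self_similar_prob[OF self_similar_mu])
    show "measure mu K2 = 1" by (rule koch.self_similar_attractor[OF self_similar_mu attractor_K2])
    show "K2 \<in> sets borel" using attractor_K2 by (simp add: koch.attractor_def compact_imp_closed)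
    show "0 \<le> a_seq n * exp (- (2 * s2 / (2 ^ n * d0)))" using a_seq_nonneg by simp
  qed (rule mass_bound)
qed

end
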